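(* Let $(a_n)_{n \geq 1}$ be a sequence of integers with $a_n \ll e^{\gamma (\log n)^2}$ for some $\gamma > 0$ which is convex, i.e., which satisfies $$a_{n+1} - a_n > a_n - a_{n-1} \quad \text{for all } n \geq 2.$$ Then for (Lebesgue) almost all $\alpha \in \mathbb{R}$ the star-discrepancy $D_N^* = D_N^*(\{a_1\alpha\}, \ldots, \{a_N\alpha\})$ of the sequence $(\{a_n \alpha\})_{n \geq 1}$ satisfies $$N D_N^* = \Omega\left(N^{\frac{7}{26} - \varepsilon}\right) \quad \text{for all } \varepsilon > 0.$$
   Context: $\{x\}$ denotes the fractional part of a real number $x$. For points $x_1, \ldots, x_N \in [0,1)$ the star-discrepancy is $D_N^*(x_1,\ldots,x_N) := \sup_{0 < \beta \leq 1} \left| \frac{A_N(\beta)}{N} - \beta \right|$, where $A_N(\beta) := \#\{1 \leq n \leq N : x_n \in [0,\beta)\}$. The condition $a_n \ll e^{\gamma(\log n)^2}$ means that there is a constant $C$ with $a_n \leq C e^{\gamma(\log n)^2}$ for all $n \ge 1$. $f(N) = \Omega(g(N))$ means that there is a constant $c > 0$ with $f(N) \geq c\, g(N)$ for infinitely many $N$. *)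

theory Defs
  imports "HOL-Analysis.Analysis"
begin

text \<open>Sequences are indexed by the positive integers; the value at index 0 is never used.\<close>

definition count_below :: "(nat \<Rightarrow> real) \<Rightarrow> nat \<Rightarrow> real \<Rightarrow> nat" where
  "count_below x N \<beta> = card {n \<in> {1..N}. x n \<in> {0..<\<beta>}}"

definition star_discrepancy :: "(nat \<Rightarrow> real) \<Rightarrow> nat \<Rightarrow> real" where
  "star_discrepancy x N = (SUP \<beta>\<in>{0<..1}. \<bar>real (count_below x N \<beta>) / real N - \<beta>\<bar>)"

text \<open>The Hardy--Littlewood Omega, a lower bound holding for infinitely many arguments. The Omega of
  \<^theory>\<open>HOL-Library.Landau_Symbols\<close> demands the lower bound for all large arguments and is
  strictly stronger.\<close>

definition omega_io :: "(nat \<Rightarrow> real) \<Rightarrow> (nat \<Rightarrow> real) \<Rightarrow> bool" where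
  "omega_io f g \<longleftrightarrow> (\<exists>c>0. infinite {N. f N \<ge> c * g N})"

end

(*
Let F_N(x) be the sum of e(a_n x) over n <= N, and E the additive energy of {a_1, ..., a_N}. Since F_N
has second moment N and fourth moment E, its first moment is at least of order N^(3/2) E^(-1/2), and
Shkredov's bound E << N^(32/13 + o(1)) for convex sets makes this N^(7/26 - o(1)). Hence there is
a level t such that |F_N| >= t on a set of measure m >= N^(7/26 - o(1)) / t. As the dilates by
distinct primes are nearly orthogonal, all x outside a set of small measure have a prime
p <= Q = N^(o(1)) / m for which px lies in that set. Partial summation gives |F_N(px)| <= 2 pi p N D_N^*(x), and so N D_N^*(x) is at least
of order t / Q, that is N^(7/26 - o(1)). The exceptional sets have measure tending to 0, which
suffices for a lower bound holding infinitely often.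
*)
theory Submission
  imports Defs "HOL-Real_Asymp.Real_Asymp"
begin

section \<open>Additive energy of convex sets\<close>

text \<open>The exponent is 3/2 - (32/13)/2 = 7/26, the energy entering under a square root. Only
  the product of the level t and the measure m is controlled, neither factor alone. No level is
  worse than another, though: a small m calls for more primes, but then t is large and compensates
  for the factor p lost in passing back to x. Primes serve because a nonzero frequency h is produced
  by the dilate by p only if p divides h, hence by at most log2 |h| of the dilates. The growth
  hypothesis bounds this multiplicity by O((log N)^2), which a power of N with arbitrarily small
  exponent absorbs; nothing finer about the size of the sequence enters. The variance estimate needs
  a finite list of frequencies, which the indicator of a level set does not have. Hence the
  smoothing by Bernstein polynomials: they multiply the degree by a power of N, and the degree is
  seen only through its logarithm.\<close>

definition rep :: "int set \<Rightarrow> int set \<Rightarrow> int \<Rightarrow> nat" where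
  "rep A B x = card {a \<in> A. a - x \<in> B}"

text \<open>Passing from i to i + 1 trades the gap after i for the later, larger gap after i + j. A
  difference over a fixed distance j therefore determines where it starts.\<close>

lemma strict_mono_shifted_difference:
  fixes b :: "nat \<Rightarrow> int"
  assumes "strict_mono (\<lambda>i. b (Suc i) - b i)" "j > 0"
  shows "strict_mono (\<lambda>i. b (i + j) - b i)"
proof -
  have "b (Suc (i + Suc j)) - b (Suc i) > b (i + Suc j) - b i" for i j
  proof -
    have "b (Suc i) - b i < b (Suc (i + Suc j)) - b (i + Suc j)"
      using assms(1)[THEN strict_monoD, of i "i + Suc j"] by simp
    thus ?thesis by simp
  qed
  from this[of _ "j - 1"] show ?thesis
    using assms(2) by (simp add: strict_mono_Suc_iff)
qed

lemma sum_rep_le: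
  assumes "finite A" "finite B" "finite X"
  shows "(\<Sum>x\<in>X. rep A B x) \<le> card A * card B"
proof -
  have "(\<Sum>x\<in>X. rep A B x) = card (Sigma X (\<lambda>x. {a \<in> A. a - x \<in> B}))"
    using assms by (simp add: rep_def)
  also have "\<dots> \<le> card (A \<times> B)"
    by (rule card_inj_on_le[of "\<lambda>(x,a). (a, a - x)"]) (use assms in \<open>auto simp: inj_on_def\<close>)
  finally show ?thesis by (simp add: card_cartesian_product)
qed

text \<open>An elementary substitute for the Szemeredi--Trotter theorem. For fixed \<open>x\<close> the solutions of
  \<open>b i - x \<in> B\<close> form an increasing chain of points (index, rank in \<open>B\<close>), so most of them share a cell of a
  grid with about \<open>\<tau>\<close> rows and columns with a later one. Such a pair is determined by its offset in the
  cell and its first element of \<open>B\<close>: convexity recovers \<open>i\<close> from \<open>b (i + j) - b i\<close>.\<close>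

lemma convex_rep_level_bound:
  fixes b :: "nat \<Rightarrow> int"
  assumes mono: "strict_mono b" and conv: "strict_mono (\<lambda>i. b (Suc i) - b i)"
    and fin: "finite B" "finite X" and tau: "\<tau> \<ge> 1"
    and X: "\<And>x. x \<in> X \<Longrightarrow> \<tau> \<le> rep (b ` {..<N}) B x"
  shows "card X * \<tau> ^ 3 \<le> 162 * N * (card B)\<^sup>2"
proof (cases "X = {}")
  case False
  define I where "I x = {i. i < N \<and> b i - x \<in> B}" for x
  define m where "m = card B"
  have injb: "inj b" using mono by (rule strict_mono_imp_inj_on)
  have finI: "finite (I x)" for x by (auto simp: I_def)
  have cardI: "card (I x) = rep (b ` {..<N}) B x" for x
  proof -
    have "{a \<in> b ` {..<N}. a - x \<in> B} = b ` I x" by (auto simp: I_def)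
    thus ?thesis by (simp add: rep_def card_image inj_on_subset[OF injb])
  qed
  have tauI: "\<tau> \<le> card (I x)" if "x \<in> X" for x using X[OF that] cardI by simp
  obtain x0 where x0: "x0 \<in> X" using False by auto
  have "card (I x0) \<le> card {..<N}" by (rule card_mono) (auto simp: I_def)
  hence tauN: "\<tau> \<le> N" using tauI[OF x0] by simp
  have "card (I x0) \<le> card B"
    by (rule card_inj_on_le[of "\<lambda>i. b i - x0"]) (auto simp: I_def fin inj_on_def injD[OF injb])
  hence taum: "\<tau> \<le> m" using tauI[OF x0] by (simp add: m_def)
  \<comment> \<open>The grid argument leaves at least \<tau> - (\<tau>/4 + 1) elements in
    \<open>G x\<close>, which is at least \<tau>/2 once \<tau> \<ge> 4. Below that the trivial count
    of pairs is enough.\<close>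
  show ?thesis
  proof (cases "\<tau> < 4")
    case True
    have "card X * \<tau> \<le> (\<Sum>x\<in>X. rep (b ` {..<N}) B x)"
      using sum_bounded_below[of X \<tau> "rep (b ` {..<N}) B"] X by simp
    also have "\<dots> \<le> N * m"
      using sum_rep_le[of "b ` {..<N}" B X] fin
      by (simp add: card_image inj_on_subset[OF injb] m_def)
    finally have 1: "card X * \<tau> \<le> N * m" .
    have "\<tau> \<in> {1,2,3}" using True tau by auto
    hence t2: "\<tau>\<^sup>2 \<le> 9" by auto
    have "card X * \<tau> ^ 3 = (card X * \<tau>) * \<tau>\<^sup>2" by (simp add: power2_eq_square power3_eq_cube)
    also have "\<dots> \<le> (N * m) * 9" by (intro mult_mono 1 t2) auto
    also have "\<dots> \<le> 162 * N * m\<^sup>2" using taum tau by (simp add: power2_eq_square)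
    finally show ?thesis by (simp add: m_def)
  next
    case False
    define rank where "rank \<beta> = card {\<beta>' \<in> B. \<beta>' < \<beta>}" for \<beta>
    have rank_mono: "rank \<beta> < rank \<beta>'" if "\<beta> \<in> B" "\<beta> < \<beta>'" for \<beta> \<beta>'
      unfolding rank_def by (rule psubset_card_mono) (use that fin in auto)
    have rank_inj: "\<beta> = \<beta>'" if "\<beta> \<in> B" "\<beta>' \<in> B" "rank \<beta> = rank \<beta>'" for \<beta> \<beta>'
      using that rank_mono[of \<beta> \<beta>'] rank_mono[of \<beta>' \<beta>] by (metis less_irrefl linorder_neqE)
    have rank_le: "rank \<beta> \<le> m" for \<beta>
      unfolding rank_def m_def by (rule card_mono) (use fin in auto)
    \<comment> \<open>Cells this wide leave at most \<tau>/8 + 1 columns and as many rows. As \<tau>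
      \<le> N and \<tau> \<le> m, rounding up costs a 9 in place of the 8, and 162 = 2 * 9 *
      9.\<close>
    define lA where "lA = 8 * N div \<tau> + 1"
    define lB where "lB = 8 * m div \<tau> + 1"
    have lA: "lA * \<tau> \<le> 9 * N" "8 * N \<le> lA * \<tau>"
    proof -
      have "8 * N div \<tau> * \<tau> \<le> 8 * N" by simp
      thus "lA * \<tau> \<le> 9 * N" using tauN unfolding lA_def add_mult_distrib by linarith
      have "8 * N < (8 * N div \<tau> + 1) * \<tau>"
        using tau dividend_less_div_times[of \<tau> "8 * N"] by (simp add: algebra_simps)
      thus "8 * N \<le> lA * \<tau>" by (simp add: lA_def)
    qed
    have lB: "lB * \<tau> \<le> 9 * m" "8 * m \<le> lB * \<tau>"
    proof -
      have "8 * m div \<tau> * \<tau> \<le> 8 * m" by simp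
      thus "lB * \<tau> \<le> 9 * m" using taum unfolding lB_def add_mult_distrib by linarith
      have "8 * m < (8 * m div \<tau> + 1) * \<tau>"
        using tau dividend_less_div_times[of \<tau> "8 * m"] by (simp add: algebra_simps)
      thus "8 * m \<le> lB * \<tau>" by (simp add: lB_def)
    qed
    have pos: "lA > 0" "lB > 0" by (auto simp: lA_def lB_def)
    have "8 * (N div lA) * lA \<le> lA * \<tau>"
      using lA(2) by (metis div_times_less_eq_dividend le_trans mult.assoc mult_le_mono2)
    hence nA: "8 * (N div lA) \<le> \<tau>" using pos by (simp add: mult.commute)
    have "8 * (m div lB) * lB \<le> lB * \<tau>"
      using lB(2) by (metis div_times_less_eq_dividend le_trans mult.assoc mult_le_mono2)
    hence nB: "8 * (m div lB) \<le> \<tau>" using pos by (simp add: mult.commute)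
    \<comment> \<open>Along the chain the column and the row number are both nondecreasing, so
      equality of their sum forces equality of each. One number of size at most \<tau>/4 thus labels
      the cells that the chain visits.\<close>
    define c where "c x i = i div lA + rank (b i - x) div lB" for x i
    define G where "G x = {i \<in> I x. \<exists>i'\<in>I x. i < i' \<and> c x i = c x i'}" for x
    have finG: "finite (G x)" for x using finI by (simp add: G_def)
    have cardG: "\<tau> \<le> 2 * card (G x)" if x: "x \<in> X" for x
    proof -
      have "inj_on (c x) (I x - G x)"
        unfolding inj_on_def G_def by (metis (mono_tags, lifting) DiffE linorder_neqE_nat mem_Collect_eq)
      moreover have "c x ` (I x - G x) \<subseteq> {..N div lA + m div lB}"
        by (auto simp: c_def I_def intro!: add_mono div_le_mono rank_le)
      ultimately have "card (I x - G x) \<le> card {..N div lA + m div lB}"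
        by (intro card_inj_on_le) auto
      moreover have "card (I x - G x) = card (I x) - card (G x)"
        by (rule card_Diff_subset[OF finG]) (auto simp: G_def)
      ultimately show ?thesis using tauI[OF x] nA nB False by simp
    qed
    define s where "s x i = (SOME i'. i' \<in> I x \<and> i < i' \<and> c x i = c x i')" for x i
    have s: "s x i \<in> I x \<and> i < s x i \<and> c x i = c x (s x i)" if "i \<in> G x" for x i
      unfolding s_def by (rule someI_ex) (use that in \<open>auto simp: G_def\<close>)
    have block: "i' - i < l" if "i div l = i' div l" "i < i'" "l > 0" for i i' l :: nat
    proof -
      have "i = l * (i div l) + i mod l" "i' = l * (i' div l) + i' mod l" by auto
      moreover have "i' mod l < l" using that by simp
      ultimately show ?thesis using that(1,2) by (metis add_diff_cancel_left diff_le_self le_less_trans nat_less_le)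
    qed
    have ss: "s x i - i < lA \<and> rank (b (s x i) - x) - rank (b i - x) < lB \<and> rank (b i - x) < rank (b (s x i) - x)"
      if i: "i \<in> G x" for x i
    proof -
      have iI: "i \<in> I x" using i by (simp add: G_def)
      have lt: "i < s x i" using s[OF i] by simp
      have r: "rank (b i - x) < rank (b (s x i) - x)"
        by (rule rank_mono) (use iI lt strict_monoD[OF mono] in \<open>auto simp: I_def\<close>)
      have "i div lA \<le> s x i div lA" "rank (b i - x) div lB \<le> rank (b (s x i) - x) div lB"
        using lt r by (auto intro!: div_le_mono)
      hence "i div lA = s x i div lA" "rank (b i - x) div lB = rank (b (s x i) - x) div lB"
        using s[OF i] by (auto simp: c_def)
      thus ?thesis using block lt r pos by auto
    qed
    define h where "h = (\<lambda>(x,i). (s x i - i, b i - x, rank (b (s x i) - x) - rank (b i - x)))"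
    have "inj_on h (Sigma X G)"
    proof (rule inj_onI, clarify)
      fix x i y k
      assume i: "i \<in> G x" and k: "k \<in> G y" and eq: "h (x,i) = h (y,k)"
      define j where "j = s x i - i"
      have j: "s x i = i + j" "s y k = k + j" "j > 0"
        using s[OF i] s[OF k] eq by (auto simp: j_def h_def)
      have e1: "b i - x = b k - y" using eq by (simp add: h_def)
      have "rank (b (s x i) - x) = rank (b (s y k) - y)"
        using eq ss[OF i] ss[OF k] by (auto simp: h_def)
      hence "b (i + j) - x = b (k + j) - y"
        using s[OF i] s[OF k] by (intro rank_inj) (auto simp: I_def j)
      hence "b (i + j) - b i = b (k + j) - b k" using e1 by simp
      hence "i = k"
        using strict_mono_eq[OF strict_mono_shifted_difference[OF conv j(3)]] by blast
      thus "x = y \<and> i = k" using e1 by simp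
    qed
    moreover have "h ` Sigma X G \<subseteq> {..<lA} \<times> B \<times> {..<lB}"
      using ss by (auto simp: h_def G_def I_def)
    ultimately have "card (Sigma X G) \<le> card ({..<lA} \<times> B \<times> {..<lB})"
      by (intro card_inj_on_le) (auto simp: fin)
    hence 1: "card (Sigma X G) \<le> lA * m * lB" unfolding m_def by (simp only: card_cartesian_product card_lessThan mult.assoc)
    have "card X * \<tau> \<le> 2 * (\<Sum>x\<in>X. card (G x))"
      using sum_bounded_below[of X \<tau> "\<lambda>x. 2 * card (G x)"] cardG by (simp add: sum_distrib_left)
    also have "(\<Sum>x\<in>X. card (G x)) = card (Sigma X G)" using fin finG by simp
    finally have 2: "card X * \<tau> \<le> 2 * (lA * m * lB)" using 1 by simp
    have "card X * \<tau> ^ 3 = (card X * \<tau>) * \<tau>\<^sup>2" by (simp add: power2_eq_square power3_eq_cube)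
    also have "\<dots> \<le> 2 * (lA * m * lB) * \<tau>\<^sup>2" by (intro mult_right_mono 2) auto
    also have "\<dots> = 2 * m * ((lA * \<tau>) * (lB * \<tau>))" by (simp add: power2_eq_square)
    also have "\<dots> \<le> 2 * m * ((9 * N) * (9 * m))" by (intro mult_left_mono mult_mono lA lB) auto
    also have "\<dots> = 162 * N * (card B)\<^sup>2" by (simp add: m_def power2_eq_square)
    finally show ?thesis .
  qed
qed simp

section \<open>Energies by dyadic decomposition\<close>

definition diffs :: "int set \<Rightarrow> int set \<Rightarrow> int set" where
  "diffs A B = (\<lambda>(a, b). a - b) ` (A \<times> B)"

text \<open>Additive energy: \<open>rep A B x\<close> counts the pairs with a - b = x, so this is
  the number of solutions of a - b = a' - b'.\<close>

definition energy :: "int set \<Rightarrow> int set \<Rightarrow> real" where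
  "energy A B = (\<Sum>x\<in>diffs A B. (real (rep A B x))\<^sup>2)"

lemma finite_diffs [simp]: "finite A \<Longrightarrow> finite B \<Longrightarrow> finite (diffs A B)"
  by (simp add: diffs_def)

lemma diffsI: "a \<in> A \<Longrightarrow> b \<in> B \<Longrightarrow> a - b \<in> diffs A B"
  by (auto simp: diffs_def)

lemma rep_eq_0: "x \<notin> diffs A B \<Longrightarrow> rep A B x = 0"
proof -
  assume *: "x \<notin> diffs A B"
  have "{a \<in> A. a - x \<in> B} = {}"
    using * diffsI[of _ A _ B] by fastforce
  thus ?thesis unfolding rep_def by (simp only: card.empty)
qed

lemma rep_le_card:
  assumes "finite A"
  shows "rep A B x \<le> card A"
  unfolding rep_def using assms by (intro card_mono) auto

lemma rep_minus: "rep A A (- x) = rep A A x"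
  unfolding rep_def by (rule bij_betw_same_card[of "\<lambda>a. a + x"]) (auto intro!: bij_betwI[of _ _ _ "\<lambda>a. a - x"])

lemma rep_altdef:
  assumes "finite A"
  shows "of_nat (rep A B x) = (\<Sum>a\<in>A. of_bool (a - x \<in> B))"
  using assms by (simp add: rep_def of_bool_def sum.If_cases Int_def)

text \<open>Stated over a semiring because it groups real counts and, in the fourth moment, complex
  exponentials.\<close>

lemma sum_over_differences:
  fixes F :: "int \<Rightarrow> 'a :: comm_semiring_1"
  assumes "finite A" "finite B"
  shows "(\<Sum>a\<in>A. \<Sum>b\<in>B. F (a - b)) = (\<Sum>x\<in>diffs A B. of_nat (rep A B x) * F x)"
proof -
  have "(\<Sum>x\<in>diffs A B. of_nat (rep A B x) * F x) = (\<Sum>x\<in>diffs A B. \<Sum>a\<in>A. of_bool (a - x \<in> B) * F x)"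
    using assms by (simp add: rep_altdef sum_distrib_right)
  also have "\<dots> = (\<Sum>a\<in>A. \<Sum>x\<in>diffs A B. of_bool (a - x \<in> B) * F x)" by (rule sum.swap)
  also have "\<dots> = (\<Sum>a\<in>A. \<Sum>b\<in>B. F (a - b))"
  proof (rule sum.cong[OF refl])
    fix a assume a: "a \<in> A"
    have "(\<Sum>x\<in>diffs A B. of_bool (a - x \<in> B) * F x) = (\<Sum>x\<in>{x \<in> diffs A B. a - x \<in> B}. F x)"
      using assms by (intro sum.mono_neutral_cong_right) auto
    also have "\<dots> = (\<Sum>b\<in>B. F (a - b))"
      by (rule sum.reindex_bij_witness[of _ "\<lambda>b. a - b" "\<lambda>x. a - x"]) (use a diffsI in auto)
    finally show "(\<Sum>x\<in>diffs A B. of_bool (a - x \<in> B) * F x) = (\<Sum>b\<in>B. F (a - b))" .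
  qed
  finally show ?thesis by simp
qed

text \<open>Each positive \<open>w x\<close> lies within a factor 2 above one power
  \<open>2 ^ j\<close>, so a bound uniform in the level loses only the factor \<open>2 ^ k\<close>
  and the number of levels.\<close>

lemma dyadic_sum_le:
  fixes w :: "'a \<Rightarrow> nat" and h :: "'a \<Rightarrow> real"
  assumes fin: "finite X" and h: "\<And>x. x \<in> X \<Longrightarrow> h x \<ge> 0" and w: "\<And>x. x \<in> X \<Longrightarrow> w x < 2 ^ K"
    and k: "k > 0"
    and M: "\<And>j. j < K \<Longrightarrow> (2 ^ j) ^ k * (\<Sum>x\<in>{x \<in> X. 2 ^ j \<le> w x}. h x) \<le> M"
  shows "(\<Sum>x\<in>X. real (w x) ^ k * h x) \<le> real K * 2 ^ k * M"
proof -
  have pw: "real (w x) ^ k \<le> (\<Sum>j<K. 2 ^ k * (2 ^ j) ^ k * of_bool (2 ^ j \<le> w x))" if x: "x \<in> X" for x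
  proof (cases "w x = 0")
    case True
    thus ?thesis using k by (simp add: zero_power)
  next
    case False
    then obtain j where j: "2 ^ j \<le> w x" "w x < 2 ^ (j + 1)"
      using ex_power_ivl1[of 2 "w x"] by auto
    have "(2::nat) ^ j < 2 ^ K" by (rule le_less_trans[OF j(1) w[OF x]])
    hence jK: "j < K" by simp
    have "real (w x) \<le> real (2 ^ (j + 1))" using j(2) by (intro of_nat_mono) simp
    hence "real (w x) ^ k \<le> (2 * 2 ^ j) ^ k"
      by (intro power_mono) auto
    also have "\<dots> = 2 ^ k * (2 ^ j) ^ k * of_bool (2 ^ j \<le> w x)" using j by (simp add: power_mult_distrib)
    also have "\<dots> \<le> (\<Sum>j<K. 2 ^ k * (2 ^ j) ^ k * of_bool (2 ^ j \<le> w x))"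
      by (rule member_le_sum) (use jK in auto)
    finally show ?thesis .
  qed
  have "(\<Sum>x\<in>X. real (w x) ^ k * h x) \<le>
      (\<Sum>x\<in>X. (\<Sum>j<K. 2 ^ k * (2 ^ j) ^ k * of_bool (2 ^ j \<le> w x)) * h x)"
    by (intro sum_mono mult_right_mono pw h)
  also have "\<dots> = (\<Sum>j<K. \<Sum>x\<in>X. 2 ^ k * (2 ^ j) ^ k * of_bool (2 ^ j \<le> w x) * h x)"
    by (subst sum.swap) (simp only: sum_distrib_right)
  also have "\<dots> = (\<Sum>j<K. 2 ^ k * ((2 ^ j) ^ k * (\<Sum>x\<in>{x \<in> X. 2 ^ j \<le> w x}. h x)))"
  proof (rule sum.cong[OF refl])
    fix j
    have "(\<Sum>x\<in>X. 2 ^ k * (2 ^ j) ^ k * of_bool (2 ^ j \<le> w x) * h x) =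
       (\<Sum>x\<in>{x \<in> X. 2 ^ j \<le> w x}. 2 ^ k * (2 ^ j) ^ k * h x)"
      using fin by (intro sum.mono_neutral_cong_right) auto
    thus "(\<Sum>x\<in>X. 2 ^ k * (2 ^ j) ^ k * of_bool (2 ^ j \<le> w x) * h x) =
       2 ^ k * ((2 ^ j) ^ k * (\<Sum>x\<in>{x \<in> X. 2 ^ j \<le> w x}. h x))"
      by (simp add: sum_distrib_left mult.assoc)
  qed
  also have "\<dots> \<le> (\<Sum>j<K. 2 ^ k * M)" by (intro sum_mono mult_left_mono M) auto
  finally show ?thesis by (simp add: mult.assoc)
qed

text \<open>A level set is bounded trivially with weight \<tau> and by convexity with weight
  \<tau>^3. The geometric mean of the two bounds has the weight \<tau>^2 of the energy.\<close>

lemma convex_energy_bound: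
  fixes b :: "nat \<Rightarrow> int"
  assumes mono: "strict_mono b" and conv: "strict_mono (\<lambda>i. b (Suc i) - b i)"
    and fin: "finite B" and K: "N < 2 ^ K"
  shows "(energy (b ` {..<N}) B)\<^sup>2 \<le> 16 * real K ^ 2 * 162 * real N ^ 2 * real (card B) ^ 3"
proof -
  define A where "A = b ` {..<N}"
  have cA: "card A = N" "finite A"
    using strict_mono_imp_inj_on[OF mono] by (auto simp: A_def card_image inj_on_subset)
  define m where "m = card B"
  define M where "M = sqrt (162 * real N ^ 2 * real m ^ 3)"
  have "(\<Sum>x\<in>diffs A B. real (rep A B x) ^ 2 * 1) \<le> real K * 2 ^ 2 * M"
  proof (rule dyadic_sum_le)
    fix j assume "j < K"
    define X where "X = {x \<in> diffs A B. 2 ^ j \<le> rep A B x}"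
    have finX: "finite X" using cA fin by (simp add: X_def)
    have "card X * 2 ^ j \<le> (\<Sum>x\<in>X. rep A B x)"
      using sum_bounded_below[of X "2 ^ j" "rep A B"] by (simp add: X_def)
    also have "\<dots> \<le> N * m" using sum_rep_le[of A B X] cA fin finX by (simp add: m_def)
    finally have 1: "card X * 2 ^ j \<le> N * m" .
    have 2: "card X * (2 ^ j) ^ 3 \<le> 162 * N * m\<^sup>2"
      unfolding m_def by (rule convex_rep_level_bound[OF mono conv fin finX]) (auto simp: X_def A_def)
    have "(card X * (2 ^ j) ^ 2)\<^sup>2 = (card X * 2 ^ j) * (card X * (2 ^ j) ^ 3)"
      by (simp add: power2_eq_square power3_eq_cube algebra_simps)
    also have "\<dots> \<le> (N * m) * (162 * N * m\<^sup>2)" by (intro mult_mono 1 2) auto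
    also have "\<dots> = 162 * N ^ 2 * m ^ 3" by (simp add: power2_eq_square power3_eq_cube)
    finally have "real ((card X * (2 ^ j) ^ 2)\<^sup>2) \<le> real (162 * N ^ 2 * m ^ 3)"
      by (rule of_nat_mono)
    hence "real (card X * (2 ^ j) ^ 2) \<le> M"
      unfolding M_def by (intro real_le_rsqrt) simp
    thus "(2 ^ j) ^ 2 * (\<Sum>x\<in>{x \<in> diffs A B. 2 ^ j \<le> rep A B x}. 1) \<le> M"
      by (simp add: X_def mult.commute)
  qed (use cA fin K rep_le_card[of A B] in \<open>auto intro: le_less_trans\<close>)
  hence E: "energy A B \<le> 4 * real K * M" by (simp add: energy_def mult.commute)
  have "0 \<le> energy A B" unfolding energy_def by (intro sum_nonneg) auto
  hence "(energy A B)\<^sup>2 \<le> (4 * real K * M)\<^sup>2" by (intro power_mono E)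
  also have "\<dots> = 16 * real K ^ 2 * (162 * real N ^ 2 * real m ^ 3)"
    by (simp add: power_mult_distrib M_def)
  finally show ?thesis by (simp add: A_def m_def mult.assoc)
qed

text \<open>The cube is the weight of the level bound itself, so all levels contribute equally and
  only their number is lost.\<close>

lemma convex_third_energy_bound:
  fixes b :: "nat \<Rightarrow> int"
  defines "A \<equiv> \<lambda>N. b ` {..<N}"
  assumes mono: "strict_mono b" and conv: "strict_mono (\<lambda>i. b (Suc i) - b i)"
    and K: "N < 2 ^ K"
  shows "(\<Sum>x\<in>diffs (A N) (A N). real (rep (A N) (A N) x) ^ 3) \<le> 8 * real K * 162 * real N ^ 3"
proof -
  have cA: "card (A N) = N" "finite (A N)"
    using strict_mono_imp_inj_on[OF mono] by (auto simp: A_def card_image inj_on_subset)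
  have "(\<Sum>x\<in>diffs (A N) (A N). real (rep (A N) (A N) x) ^ 3 * 1) \<le> real K * 2 ^ 3 * (162 * real N ^ 3)"
  proof (rule dyadic_sum_le)
    fix j assume "j < K"
    define X where "X = {x \<in> diffs (A N) (A N). 2 ^ j \<le> rep (A N) (A N) x}"
    have finX: "finite X" using cA by (simp add: X_def)
    have 2: "card X * (2 ^ j) ^ 3 \<le> 162 * N * (card (A N))\<^sup>2"
      by (rule convex_rep_level_bound[OF mono conv cA(2) finX]) (auto simp: X_def A_def)
    have "real (card X * (2 ^ j) ^ 3) \<le> real (162 * N * (card (A N))\<^sup>2)"
      by (rule of_nat_mono) (rule 2)
    thus "(2 ^ j) ^ 3 * (\<Sum>x\<in>{x \<in> diffs (A N) (A N). 2 ^ j \<le> rep (A N) (A N) x}. 1) \<le> 162 * real N ^ 3"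
      by (simp add: X_def mult.commute cA power2_eq_square power3_eq_cube)
  qed (use cA K rep_le_card[of "A N" "A N"] in \<open>auto intro: le_less_trans\<close>)
  thus ?thesis by (simp add: algebra_simps)
qed

section \<open>Popular differences and higher energies\<close>

text \<open>A shift w carrying y and z into \<open>A\<close> is recorded by a = y + w, whose partner
  a - (y - z) = z + w must lie in \<open>A\<close> as well.\<close>

lemma sum_of_bool_rep:
  assumes "finite A" "y \<in> A" "z \<in> A"
  shows "(\<Sum>w\<in>diffs A A. of_bool (y + w \<in> A) * of_bool (z + w \<in> A)) = real (rep A A (y - z))"
proof -
  have "(\<Sum>w\<in>diffs A A. of_bool (y + w \<in> A) * of_bool (z + w \<in> A)) =
      (\<Sum>w\<in>{w \<in> diffs A A. y + w \<in> A \<and> z + w \<in> A}. 1::real)"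
    using assms by (intro sum.mono_neutral_cong_right) auto
  also have "\<dots> = (\<Sum>a\<in>{a \<in> A. a - (y - z) \<in> A}. 1::real)"
    by (rule sum.reindex_bij_witness[of _ "\<lambda>a. a - y" "\<lambda>w. y + w"])
      (use assms diffsI in \<open>auto simp: algebra_simps\<close>)
  finally show ?thesis by (simp add: rep_def)
qed

lemma sum_of_bool_rep':
  assumes "finite A" "x \<in> A" "x' \<in> A"
  shows "(\<Sum>s\<in>diffs A A. of_bool (x - s \<in> A) * of_bool (x' - s \<in> A)) = real (rep A A (x' - x))"
proof -
  have "(\<Sum>w\<in>diffs A A. of_bool (x - w \<in> A) * of_bool (x' - w \<in> A)) =
      (\<Sum>w\<in>{w \<in> diffs A A. x - w \<in> A \<and> x' - w \<in> A}. 1::real)"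
    using assms by (intro sum.mono_neutral_cong_right) auto
  also have "\<dots> = (\<Sum>a\<in>{a \<in> A. a - (x' - x) \<in> A}. 1::real)"
    by (rule sum.reindex_bij_witness[of _ "\<lambda>a. x' - a" "\<lambda>w. x' - w"])
      (use assms diffsI in \<open>auto simp: algebra_simps\<close>)
  finally show ?thesis by (simp add: rep_def)
qed

text \<open>Shkredov's higher energy argument. The number of triples \<open>(x, y, z)\<close> in \<open>A\<close> with \<open>x - y\<close> and
  \<open>x - z\<close> popular, weighted by \<open>r (y - z)\<close>, is the trace of a positive semidefinite operator; it is
  bounded below by Cauchy--Schwarz and above through the third moment of \<open>r\<close>.\<close>

locale popular_differences =
  fixes A :: "int set" and \<tau> :: nat
  assumes fin: "finite A" and tau: "\<tau> > 0"
begin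

abbreviation "r \<equiv> rep A A"
abbreviation "W \<equiv> diffs A A"
definition "D = {x \<in> W. \<tau> \<le> r x}"
abbreviation "dD x \<equiv> of_bool (x \<in> D) :: real"
abbreviation "dA x \<equiv> of_bool (x \<in> A) :: real"
text \<open>Written as a sum of squares, the form that Cauchy-Schwarz bounds from below. Expanding
  the square and summing over w produces the weight r (y - z).\<close>

definition "triangles = (\<Sum>x\<in>A. \<Sum>w\<in>W. (\<Sum>y\<in>A. dD (x - y) * dA (y + w))\<^sup>2)"
text \<open>The squared Hilbert-Schmidt norm of the matrix with entries r (t - s) on the popular
  differences.\<close>

definition "T = (\<Sum>s\<in>D. \<Sum>t\<in>D. (real (r (t - s)))\<^sup>2)"

lemma D_sub: "D \<subseteq> W" and finD [simp]: "finite D" and finW [simp]: "finite W"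
  using fin by (auto simp: D_def)

lemma D_iff: "x \<in> D \<longleftrightarrow> \<tau> \<le> r x"
  using rep_eq_0[of x A A] tau unfolding D_def by (cases "x \<in> W") auto

text \<open>Cauchy-Schwarz is used three times: over x for each shift w, over the shifts in
  \<open>D\<close>, and over y. At the bottom of the chain, \<open>V1\<close> counts the pairs of
  \<open>A\<close> with popular difference, at least \<tau> for each element of
  \<open>D\<close>.\<close>

lemma triangles_ge: "(real (card D) * real \<tau>) ^ 4 \<le> real (card A) ^ 3 * real (card D) * triangles"
proof -
  define v where "v y = (\<Sum>x\<in>A. dD (x - y))" for y
  define V1 where "V1 = (\<Sum>y\<in>A. v y)"
  define V2 where "V2 = (\<Sum>y\<in>A. (v y)\<^sup>2)"
  define g where "g w = (\<Sum>y\<in>A. v y * dA (y + w))" for w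
  have v0: "v y \<ge> 0" for y by (simp add: v_def sum_nonneg)
  have "(\<Sum>w\<in>W. (g w)\<^sup>2) \<le> (\<Sum>w\<in>W. real (card A) * (\<Sum>x\<in>A. (\<Sum>y\<in>A. dD (x - y) * dA (y + w))\<^sup>2))"
  proof (rule sum_mono)
    fix w
    have "g w = (\<Sum>x\<in>A. \<Sum>y\<in>A. dD (x - y) * dA (y + w))"
      unfolding g_def v_def sum_distrib_right by (rule sum.swap)
    thus "(g w)\<^sup>2 \<le> real (card A) * (\<Sum>x\<in>A. (\<Sum>y\<in>A. dD (x - y) * dA (y + w))\<^sup>2)"
      using sum_squared_le_sum_of_squares[of "\<lambda>x. \<Sum>y\<in>A. dD (x - y) * dA (y + w)" A] by (simp add: mult.commute)
  qed
  also have "\<dots> = real (card A) * triangles"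
    unfolding triangles_def sum_distrib_left by (rule sum.swap)
  finally have 1: "(\<Sum>w\<in>W. (g w)\<^sup>2) \<le> real (card A) * triangles" .
  have vD: "(\<Sum>w\<in>D. dA (y + w)) = v y" if "y \<in> A" for y
  proof -
    have "(\<Sum>w\<in>D. dA (y + w)) = (\<Sum>w\<in>{w \<in> D. y + w \<in> A}. 1)"
      by (intro sum.mono_neutral_cong_right) auto
    also have "\<dots> = (\<Sum>x\<in>{x \<in> A. x - y \<in> D}. 1)"
      by (rule sum.reindex_bij_witness[of _ "\<lambda>x. x - y" "\<lambda>w. y + w"]) auto
    also have "\<dots> = v y"
      unfolding v_def using fin by (intro sum.mono_neutral_cong_left) auto
    finally show ?thesis .
  qed
  \<comment> \<open>For w in \<open>D\<close>, an element y + w of \<open>A\<close> is again some x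
    with x - y in \<open>D\<close>; so summing \<open>g\<close> over \<open>D\<close> gives the
    second moment of \<open>v\<close>.\<close>
  have "(\<Sum>w\<in>D. g w) = (\<Sum>y\<in>A. v y * (\<Sum>w\<in>D. dA (y + w)))"
    unfolding g_def sum_distrib_left by (rule sum.swap)
  also have "\<dots> = V2" unfolding V2_def by (intro sum.cong refl) (simp only: vD power2_eq_square)
  finally have "V2\<^sup>2 \<le> (\<Sum>w\<in>D. (g w)\<^sup>2) * real (card D)"
    using sum_squared_le_sum_of_squares[of g D] by simp
  also have "(\<Sum>w\<in>D. (g w)\<^sup>2) \<le> (\<Sum>w\<in>W. (g w)\<^sup>2)"
    by (intro sum_mono2 D_sub) auto
  finally have 2: "V2\<^sup>2 \<le> real (card A) * triangles * real (card D)"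
    using 1 by (meson mult_right_mono of_nat_0_le_iff order_trans)
  have 3: "V1\<^sup>2 \<le> V2 * real (card A)"
    unfolding V1_def V2_def by (rule sum_squared_le_sum_of_squares)
  have "V1 = (\<Sum>x\<in>W. real (r x) * dD x)"
    unfolding V1_def v_def sum_over_differences[OF fin fin, symmetric] by (rule sum.swap)
  also have "\<dots> = (\<Sum>x\<in>D. real (r x))"
    using D_sub by (intro sum.mono_neutral_cong_right) auto
  also have "\<dots> \<ge> real (card D) * real \<tau>"
    using sum_bounded_below[of D "real \<tau>" "\<lambda>x. real (r x)"] by (simp add: D_def)
  finally have 4: "real (card D) * real \<tau> \<le> V1" .
  have "(real (card D) * real \<tau>) ^ 4 \<le> V1 ^ 4" by (intro power_mono 4) auto
  also have "\<dots> = (V1\<^sup>2)\<^sup>2" by simp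
  also have "\<dots> \<le> (V2 * real (card A))\<^sup>2" by (intro power_mono 3) auto
  also have "\<dots> = V2\<^sup>2 * (real (card A))\<^sup>2" by (simp add: power_mult_distrib)
  also have "\<dots> \<le> (real (card A) * triangles * real (card D)) * (real (card A))\<^sup>2"
    by (intro mult_right_mono 2) auto
  finally show ?thesis by (simp add: power2_eq_square power3_eq_cube algebra_simps)
qed

lemma sum_dD_reindex:
  assumes "x \<in> A"
  shows "(\<Sum>y\<in>A. dD (x - y) * H y) = (\<Sum>s\<in>D. dA (x - s) * (H (x - s)::real))"
proof -
  have "(\<Sum>y\<in>A. dD (x - y) * H y) = (\<Sum>y\<in>{y \<in> A. x - y \<in> D}. H y)"
    using fin by (intro sum.mono_neutral_cong_right) auto
  also have "\<dots> = (\<Sum>s\<in>{s \<in> D. x - s \<in> A}. H (x - s))"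
    by (rule sum.reindex_bij_witness[of _ "\<lambda>s. x - s" "\<lambda>y. x - y"]) auto
  also have "\<dots> = (\<Sum>s\<in>D. dA (x - s) * (H (x - s)::real))"
    by (intro sum.mono_neutral_cong_left) auto
  finally show ?thesis .
qed

text \<open>In the coordinates s = x - y and t = x - z the count is the inner product of r (t - s)
  with \<open>c s t\<close>, the number of x in \<open>A\<close> with x - s and x - t in
  \<open>A\<close>. The squares of \<open>c\<close> over all s and t add up to the third moment of
  r, because an ordered pair x, x' admits r (x' - x) values of s and equally many of t.\<close>

lemma triangles_le: "triangles\<^sup>2 \<le> (\<Sum>x\<in>W. real (r x) ^ 3) * T"
proof -
  define c where "c s t = (\<Sum>x\<in>A. dA (x - s) * dA (x - t))" for s t
  have "triangles = (\<Sum>x\<in>A. \<Sum>s\<in>D. \<Sum>t\<in>D. dA (x - s) * dA (x - t) * real (r (t - s)))"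
    unfolding triangles_def
  proof (rule sum.cong[OF refl])
    fix x assume x: "x \<in> A"
    have "(\<Sum>w\<in>W. (\<Sum>y\<in>A. dD (x - y) * dA (y + w))\<^sup>2) =
        (\<Sum>w\<in>W. \<Sum>y\<in>A. \<Sum>z\<in>A. dD (x - y) * dA (y + w) * (dD (x - z) * dA (z + w)))"
      by (simp add: power2_eq_square sum_product)
    also have "\<dots> = (\<Sum>y\<in>A. \<Sum>w\<in>W. \<Sum>z\<in>A. dD (x - y) * dA (y + w) * (dD (x - z) * dA (z + w)))"
      by (rule sum.swap)
    also have "\<dots> = (\<Sum>y\<in>A. \<Sum>z\<in>A. \<Sum>w\<in>W. dD (x - y) * dA (y + w) * (dD (x - z) * dA (z + w)))"
      by (intro sum.cong refl sum.swap)
    also have "\<dots> = (\<Sum>y\<in>A. \<Sum>z\<in>A. dD (x - y) * (dD (x - z) * real (r (y - z))))"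
      by (intro sum.cong refl)
        (simp add: sum_of_bool_rep[OF fin, symmetric] sum_distrib_left mult_ac del: of_bool_eq_0_iff)
    also have "\<dots> = (\<Sum>y\<in>A. dD (x - y) * (\<Sum>z\<in>A. dD (x - z) * real (r (y - z))))"
      by (simp add: sum_distrib_left)
    also have "\<dots> = (\<Sum>s\<in>D. dA (x - s) * (\<Sum>t\<in>D. dA (x - t) * real (r (x - s - (x - t)))))"
      by (simp only: sum_dD_reindex[OF x])
    also have "\<dots> = (\<Sum>s\<in>D. \<Sum>t\<in>D. dA (x - s) * dA (x - t) * real (r (t - s)))"
      by (simp add: sum_distrib_left mult.assoc del: of_bool_eq_0_iff sum_of_bool_mult_eq sum_mult_of_bool_eq)
    finally show "(\<Sum>w\<in>W. (\<Sum>y\<in>A. dD (x - y) * dA (y + w))\<^sup>2) =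
       (\<Sum>s\<in>D. \<Sum>t\<in>D. dA (x - s) * dA (x - t) * real (r (t - s)))" .
  qed
  also have "\<dots> = (\<Sum>s\<in>D. \<Sum>x\<in>A. \<Sum>t\<in>D. dA (x - s) * dA (x - t) * real (r (t - s)))"
    by (rule sum.swap)
  also have "\<dots> = (\<Sum>s\<in>D. \<Sum>t\<in>D. \<Sum>x\<in>A. dA (x - s) * dA (x - t) * real (r (t - s)))"
    by (intro sum.cong refl sum.swap)
  also have "\<dots> = (\<Sum>s\<in>D. \<Sum>t\<in>D. c s t * real (r (t - s)))"
    by (simp add: c_def sum_distrib_right)
  finally have M: "triangles = (\<Sum>p\<in>D \<times> D. c (fst p) (snd p) * real (r (snd p - fst p)))"
    by (simp add: sum.cartesian_product case_prod_beta)
  have "triangles\<^sup>2 \<le> (\<Sum>p\<in>D \<times> D. (c (fst p) (snd p))\<^sup>2) * (\<Sum>p\<in>D \<times> D. (real (r (snd p - fst p)))\<^sup>2)"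
    unfolding M by (rule Cauchy_Schwarz_ineq_sum)
  also have "\<dots> = (\<Sum>s\<in>D. \<Sum>t\<in>D. (c s t)\<^sup>2) * T"
    by (simp add: T_def sum.cartesian_product case_prod_beta)
  also have "\<dots> \<le> (\<Sum>s\<in>W. \<Sum>t\<in>W. (c s t)\<^sup>2) * T"
  proof (intro mult_right_mono)
    have "(\<Sum>s\<in>D. \<Sum>t\<in>D. (c s t)\<^sup>2) \<le> (\<Sum>s\<in>D. \<Sum>t\<in>W. (c s t)\<^sup>2)"
      by (intro sum_mono sum_mono2 D_sub) auto
    also have "\<dots> \<le> (\<Sum>s\<in>W. \<Sum>t\<in>W. (c s t)\<^sup>2)"
      by (intro sum_mono2 D_sub) (auto intro: sum_nonneg)
    finally show "(\<Sum>s\<in>D. \<Sum>t\<in>D. (c s t)\<^sup>2) \<le> (\<Sum>s\<in>W. \<Sum>t\<in>W. (c s t)\<^sup>2)" .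
    show "T \<ge> 0" unfolding T_def by (intro sum_nonneg) auto
  qed
  also have "(\<Sum>s\<in>W. \<Sum>t\<in>W. (c s t)\<^sup>2) =
     (\<Sum>s\<in>W. \<Sum>t\<in>W. \<Sum>x\<in>A. \<Sum>x'\<in>A. dA (x - s) * dA (x - t) * (dA (x' - s) * dA (x' - t)))"
    by (simp add: c_def power2_eq_square sum_product)
  also have "\<dots> = (\<Sum>s\<in>W. \<Sum>x\<in>A. \<Sum>t\<in>W. \<Sum>x'\<in>A. dA (x - s) * dA (x - t) * (dA (x' - s) * dA (x' - t)))"
    by (intro sum.cong refl sum.swap)
  also have "\<dots> = (\<Sum>s\<in>W. \<Sum>x\<in>A. \<Sum>x'\<in>A. \<Sum>t\<in>W. dA (x - s) * dA (x - t) * (dA (x' - s) * dA (x' - t)))"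
    by (intro sum.cong refl sum.swap)
  also have "\<dots> = (\<Sum>x\<in>A. \<Sum>s\<in>W. \<Sum>x'\<in>A. \<Sum>t\<in>W. dA (x - s) * dA (x - t) * (dA (x' - s) * dA (x' - t)))"
    by (rule sum.swap)
  also have "\<dots> = (\<Sum>x\<in>A. \<Sum>x'\<in>A. \<Sum>s\<in>W. \<Sum>t\<in>W. dA (x - s) * dA (x - t) * (dA (x' - s) * dA (x' - t)))"
    by (intro sum.cong refl sum.swap)
  also have "\<dots> = (\<Sum>x\<in>A. \<Sum>x'\<in>A. (\<Sum>s\<in>W. dA (x - s) * dA (x' - s)) * (\<Sum>t\<in>W. dA (x - t) * dA (x' - t)))"
    by (simp only: sum_product mult_ac)
  also have "\<dots> = (\<Sum>x\<in>A. \<Sum>x'\<in>A. (real (r (x' - x)))\<^sup>2)"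
    by (intro sum.cong refl) (simp only: sum_of_bool_rep'[OF fin] power2_eq_square)
  also have "\<dots> = (\<Sum>x'\<in>A. \<Sum>x\<in>A. (real (r (x' - x)))\<^sup>2)"
    by (rule sum.swap)
  also have "\<dots> = (\<Sum>x\<in>W. real (r x) ^ 3)"
    using sum_over_differences[OF fin fin, of "\<lambda>x. (real (r x))\<^sup>2"]
    by (simp add: power2_eq_square power3_eq_cube mult.assoc)
  finally show ?thesis .
qed

text \<open>A popular t is a - b in at least \<tau> ways. With t = s + u and u in \<open>S\<close>
  this reads a - s = b + u, and \<open>S\<close> is symmetric; so the two sides are counted by the
  representation functions of \<open>A\<close> against \<open>D\<close> and against
  \<open>S\<close>, which Cauchy-Schwarz separates into energies.\<close>

lemma popular_pairs_le:
  fixes \<sigma> :: nat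
  assumes "\<sigma> > 0"
  defines "S \<equiv> {x \<in> W. \<sigma> \<le> r x}"
  defines "n \<equiv> real (card {p \<in> D \<times> D. \<sigma> \<le> r (snd p - fst p)})"
  shows "(real \<tau> * n)\<^sup>2 \<le> energy A D * energy A S"
proof -
  define P where "P = {p \<in> D \<times> D. \<sigma> \<le> r (snd p - fst p)}"
  have finS: "finite S" by (simp add: S_def)
  have S_iff: "x \<in> S \<longleftrightarrow> \<sigma> \<le> r x" for x
    using rep_eq_0[of x A A] assms(1) unfolding S_def by (cases "x \<in> W") auto
  have finP: "finite P" by (simp add: P_def)
  have "real \<tau> * n \<le> (\<Sum>p\<in>P. real (r (snd p)))"
    using sum_bounded_below[of P "real \<tau>" "\<lambda>p. real (r (snd p))"]
    by (force simp: P_def n_def D_iff mult.commute)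
  also have "\<dots> = (\<Sum>p\<in>(\<lambda>(s,t). (s, t - s)) ` P. real (r (fst p + snd p)))"
    by (subst sum.reindex) (auto simp: inj_on_def case_prod_beta)
  also have "\<dots> \<le> (\<Sum>p\<in>D \<times> S. real (r (fst p + snd p)))"
    by (rule sum_mono2) (auto simp: finS P_def S_iff)
  also have "\<dots> = (\<Sum>s\<in>D. \<Sum>u\<in>S. \<Sum>a\<in>A. dA (a - s - u))"
    using fin by (simp add: sum.cartesian_product case_prod_beta rep_altdef algebra_simps)
  also have "\<dots> = (\<Sum>s\<in>D. \<Sum>a\<in>A. \<Sum>u\<in>S. dA (a - s - u))"
    by (intro sum.cong refl sum.swap)
  also have "\<dots> = (\<Sum>a\<in>A. \<Sum>s\<in>D. \<Sum>u\<in>S. dA (a - s - u))"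
    by (rule sum.swap)
  also have "\<dots> = (\<Sum>y\<in>diffs A D. real (rep A D y) * (\<Sum>u\<in>S. dA (y - u)))"
    by (rule sum_over_differences) (auto simp: fin)
  also have "\<dots> = (\<Sum>y\<in>diffs A D. real (rep A D y) * real (rep A S y))"
  proof (intro sum.cong refl, rule arg_cong2[of _ _ _ _ times], rule refl)
    fix y
    have "(\<Sum>u\<in>S. dA (y - u)) = (\<Sum>u\<in>{u \<in> S. y - u \<in> A}. 1)"
      using finS by (intro sum.mono_neutral_cong_right) auto
    also have "\<dots> = (\<Sum>a\<in>{a \<in> A. a - y \<in> S}. 1)"
      by (rule sum.reindex_bij_witness[of _ "\<lambda>a. y - a" "\<lambda>u. y - u"])
        (use rep_minus[of A "_ - y"] rep_minus[of A] in \<open>auto simp: S_iff\<close>)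
    finally show "(\<Sum>u\<in>S. dA (y - u)) = real (rep A S y)" by (simp add: rep_def)
  qed
  finally have 1: "real \<tau> * n \<le> (\<Sum>y\<in>diffs A D. real (rep A D y) * real (rep A S y))" .
  have "0 \<le> real \<tau> * n" by (simp add: n_def)
  hence "(real \<tau> * n)\<^sup>2 \<le> (\<Sum>y\<in>diffs A D. real (rep A D y) * real (rep A S y))\<^sup>2"
    by (intro power_mono 1)
  also have "\<dots> \<le> (\<Sum>y\<in>diffs A D. (real (rep A D y))\<^sup>2) * (\<Sum>y\<in>diffs A D. (real (rep A S y))\<^sup>2)"
    by (rule Cauchy_Schwarz_ineq_sum)
  also have "\<dots> \<le> energy A D * energy A S"
  proof (intro mult_mono)
    have "(\<Sum>y\<in>diffs A D. (real (rep A S y))\<^sup>2) = (\<Sum>y\<in>diffs A D \<inter> diffs A S. (real (rep A S y))\<^sup>2)"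
      by (rule sum.mono_neutral_right) (auto simp: fin rep_eq_0)
    also have "\<dots> \<le> energy A S" unfolding energy_def
      by (rule sum_mono2) (auto simp: fin finS)
    finally show "(\<Sum>y\<in>diffs A D. (real (rep A S y))\<^sup>2) \<le> energy A S" .
  qed (auto simp: energy_def intro!: sum_nonneg)
  finally show ?thesis .
qed

end

lemma energy_self_pos:
  assumes "finite A" "A \<noteq> {}"
  shows "energy A A > 0"
proof -
  obtain a where a: "a \<in> A" using assms by auto
  have "rep A A 0 = card A" by (simp add: rep_def)
  moreover have "0 \<in> diffs A A" using diffsI[OF a a] by simp
  moreover have "card A > 0" using assms by (simp add: card_gt_0_iff)
  ultimately show ?thesis
    unfolding energy_def using assms by (intro sum_pos2[of _ 0]) auto
qed

text \<open>On a dyadic level carrying a fair share of the energy, all the information consists of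
  monomial inequalities in the number d of popular differences, their popularity t, n and e. The
  powers are chosen so that \<open>triangles\<close>, \<open>T\<close>, d and t cancel. The energy
  returns once on the right, through the level sets inside \<open>T\<close>, which turns a 27th
  power into the 26th; keeping that power keeps all exponents integral.\<close>

theorem convex_additive_energy:
  fixes b :: "nat \<Rightarrow> int"
  defines "A \<equiv> \<lambda>N. b ` {..<N}"
  assumes mono: "strict_mono b" and conv: "strict_mono (\<lambda>i. b (Suc i) - b i)"
    and N: "N > 0" and K: "N < 2 ^ K"
  shows "energy (A N) (A N) ^ 26 \<le> 2 ^ 212 * real K ^ 39 * real N ^ 64"
proof -
  define e where "e = energy (A N) (A N)"
  have cA: "card (A N) = N" "finite (A N)"
    using strict_mono_imp_inj_on[OF mono] by (auto simp: A_def card_image inj_on_subset)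
  have e0: "e > 0" unfolding e_def using N by (intro energy_self_pos) (auto simp: A_def)
  have K0: "K > 0" using N K by (cases K) auto
  define S where "S \<sigma> = {x \<in> diffs (A N) (A N). \<sigma> \<le> rep (A N) (A N) x}" for \<sigma>
  have finS: "finite (S \<sigma>)" for \<sigma> using cA by (simp add: S_def)
  have rK: "rep (A N) (A N) x < 2 ^ K" for x
    using rep_le_card[of "A N" "A N" x] cA K by simp
  have S2: "real (card (S \<sigma>)) * real \<sigma> ^ 2 \<le> e" for \<sigma>
  proof -
    have "real (card (S \<sigma>)) * real \<sigma> ^ 2 \<le> (\<Sum>x\<in>S \<sigma>. real (rep (A N) (A N) x) ^ 2)"
      using sum_bounded_below[of "S \<sigma>" "real \<sigma> ^ 2" "\<lambda>x. real (rep (A N) (A N) x) ^ 2"]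
      by (auto simp: S_def intro: power_mono)
    also have "\<dots> \<le> e" unfolding e_def energy_def
      by (rule sum_mono2) (auto simp: S_def cA)
    finally show ?thesis .
  qed
  have S3: "real (card (S \<sigma>)) * real \<sigma> ^ 3 \<le> 162 * real N ^ 3" if "\<sigma> > 0" for \<sigma>
  proof -
    have "card (S \<sigma>) * \<sigma> ^ 3 \<le> 162 * N * (card (A N))\<^sup>2"
      by (rule convex_rep_level_bound[OF mono conv cA(2) finS]) (use that in \<open>auto simp: S_def A_def\<close>)
    hence "real (card (S \<sigma>) * \<sigma> ^ 3) \<le> real (162 * N * (card (A N))\<^sup>2)"
      by (rule of_nat_mono)
    thus ?thesis by (simp add: cA power2_eq_square power3_eq_cube)
  qed
  \<comment> \<open>The 8 is twice the factor \<open>2 ^ 2\<close> of the dyadic sum; were every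
    level smaller, e \<le> e / 2 would follow.\<close>
  have "\<exists>j<K. real (card (S (2 ^ j))) * real (2 ^ j) ^ 2 \<ge> e / (8 * real K)"
  proof (rule ccontr)
    assume neg: "\<not> ?thesis"
    have "(\<Sum>x\<in>diffs (A N) (A N). real (rep (A N) (A N) x) ^ 2 * 1) \<le> real K * 2 ^ 2 * (e / (8 * real K))"
    proof (rule dyadic_sum_le)
      fix j assume "j < K"
      hence "real (card (S (2 ^ j))) * real (2 ^ j) ^ 2 \<le> e / (8 * real K)"
        using neg by auto
      thus "(2 ^ j) ^ 2 * (\<Sum>x\<in>{x \<in> diffs (A N) (A N). 2 ^ j \<le> rep (A N) (A N) x}. 1) \<le> e / (8 * real K)"
        by (simp add: S_def mult.commute)
    qed (use cA rK in auto)
    hence "e \<le> e / 2" using K0 by (simp add: e_def energy_def)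
    thus False using e0 by simp
  qed
  then obtain j where j: "j < K" "real (card (S (2 ^ j))) * real (2 ^ j) ^ 2 \<ge> e / (8 * real K)" by auto
  define \<tau> :: nat where "\<tau> = 2 ^ j"
  interpret popular_differences "A N" \<tau>
    by standard (auto simp: cA \<tau>_def)
  have DS: "D = S \<tau>" by (simp add: D_def S_def)
  define d where "d = real (card D)"
  define t where "t = real \<tau>"
  define n where "n = real N"
  define k where "k = real K"
  have pos: "n > 0" "k > 0" "t > 0" using N K0 by (auto simp: n_def k_def t_def \<tau>_def)
  have i1: "e / (8 * k) \<le> d * t ^ 2" using j(2) unfolding d_def t_def k_def DS unfolding \<tau>_def by simp
  have "e / (8 * k) > 0" using e0 pos by simp
  hence "d * t ^ 2 > 0" using i1 by linarith
  hence d0: "d > 0" using pos by (simp add: zero_less_mult_iff)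
  have i2: "d * t ^ 3 \<le> 162 * n ^ 3" unfolding d_def t_def n_def DS by (rule S3) (simp add: \<tau>_def)
  have "(d * t) ^ 4 \<le> n ^ 3 * d * triangles"
    using triangles_ge by (simp add: d_def t_def n_def cA)
  hence "d * (d ^ 3 * t ^ 4) \<le> d * (n ^ 3 * triangles)"
    by (simp add: power_mult_distrib algebra_simps power3_eq_cube power4_eq_xxxx)
  hence i3: "d ^ 3 * t ^ 4 \<le> n ^ 3 * triangles" using d0 by simp
  have T0: "T \<ge> 0" unfolding T_def by (intro sum_nonneg) auto
  have "triangles\<^sup>2 \<le> (8 * real K * 162 * real N ^ 3) * T"
    using triangles_le convex_third_energy_bound[OF mono conv K] T0
    unfolding A_def by (meson mult_right_mono order_trans)
  hence i4: "triangles\<^sup>2 \<le> 1296 * k * n ^ 3 * T" by (simp add: k_def n_def algebra_simps)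
  \<comment> \<open>This bounds the fourth power of \<sigma>^2 t u, where u counts the pairs with r
    (t - s) \<ge> \<sigma>: two energies contribute d^3 and s^3, with s the size of the level set of
    \<sigma>, and \<sigma>^8 s^3 = (s \<sigma>^2) (s \<sigma>^3)^2 is at most e (162 n^3)^2. The
    result is independent of \<sigma>.\<close>
  define X where "X = (2592 * k ^ 2 * n ^ 2) ^ 2 * d ^ 3 * e * (162 * n ^ 3) ^ 2"
  have X0: "X \<ge> 0" unfolding X_def using pos d0 e0 by auto
  have EB: "(energy (A N) B)\<^sup>2 \<le> 2592 * k ^ 2 * n ^ 2 * real (card B) ^ 3" if "finite B" for B
    using convex_energy_bound[OF mono conv that K] by (simp add: A_def k_def n_def algebra_simps)
  have "T = (\<Sum>p\<in>D \<times> D. real (r (snd p - fst p)) ^ 2 * 1)"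
    by (simp add: T_def sum.cartesian_product case_prod_beta)
  also have "\<dots> \<le> real K * 2 ^ 2 * (root 4 X / t)"
  proof (rule dyadic_sum_le)
    fix i assume "i < K"
    define \<sigma> :: nat where "\<sigma> = 2 ^ i"
    define u where "u = real (card {p \<in> D \<times> D. \<sigma> \<le> r (snd p - fst p)})"
    define s where "s = real (card (S \<sigma>))"
    define g where "g = real \<sigma>"
    have g0: "g > 0" by (simp add: g_def \<sigma>_def)
    have "(t * u)\<^sup>2 \<le> energy (A N) D * energy (A N) (S \<sigma>)"
      using popular_pairs_le[of \<sigma>] by (simp add: u_def t_def S_def \<sigma>_def)
    hence "((t * u)\<^sup>2)\<^sup>2 \<le> (energy (A N) D * energy (A N) (S \<sigma>))\<^sup>2"
      by (intro power_mono) auto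
    also have "\<dots> = (energy (A N) D)\<^sup>2 * (energy (A N) (S \<sigma>))\<^sup>2" by (rule power_mult_distrib)
    also have "\<dots> \<le> (2592 * k ^ 2 * n ^ 2 * d ^ 3) * (2592 * k ^ 2 * n ^ 2 * s ^ 3)"
      unfolding d_def s_def using pos by (intro mult_mono EB) (auto simp: finS)
    finally have 1: "(t * u) ^ 4 \<le> (2592 * k ^ 2 * n ^ 2) ^ 2 * d ^ 3 * s ^ 3"
      by (simp add: power2_eq_square power3_eq_cube power4_eq_xxxx algebra_simps)
    have "(g ^ 2 * (t * u)) ^ 4 = g ^ 8 * (t * u) ^ 4"
      by (simp add: power_mult_distrib flip: power_mult)
    also have "\<dots> \<le> g ^ 8 * ((2592 * k ^ 2 * n ^ 2) ^ 2 * d ^ 3 * s ^ 3)"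
      using 1 by (intro mult_left_mono) auto
    also have "\<dots> = (2592 * k ^ 2 * n ^ 2) ^ 2 * d ^ 3 * ((s * g ^ 2) * (s * g ^ 3) ^ 2)"
      by (simp add: power_mult_distrib power2_eq_square power3_eq_cube eval_nat_numeral)
    also have "\<dots> \<le> (2592 * k ^ 2 * n ^ 2) ^ 2 * d ^ 3 * (e * (162 * n ^ 3) ^ 2)"
    proof -
      have "s * g ^ 2 \<le> e" unfolding s_def g_def by (rule S2)
      moreover have "s * g ^ 3 \<le> 162 * n ^ 3" unfolding s_def g_def n_def by (rule S3) (simp add: \<sigma>_def)
      moreover have "s * g ^ 3 \<ge> 0" using g0 by (simp add: s_def)
      ultimately have "(s * g ^ 2) * (s * g ^ 3) ^ 2 \<le> e * (162 * n ^ 3) ^ 2"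
        using e0 by (intro mult_mono[of "s * g ^ 2"] power_mono) auto
      thus ?thesis using d0 by (intro mult_left_mono) auto
    qed
    finally have "(g ^ 2 * (t * u)) ^ 4 \<le> X" by (simp add: X_def mult.assoc)
    hence "root 4 ((g ^ 2 * (t * u)) ^ 4) \<le> root 4 X" by simp
    moreover have "g ^ 2 * (t * u) \<ge> 0" using pos g0 by (simp add: u_def)
    ultimately have "g ^ 2 * (t * u) \<le> root 4 X" by (simp add: real_root_power_cancel)
    hence "g ^ 2 * u \<le> root 4 X / t" using pos by (simp add: field_simps)
    thus "(2 ^ i) ^ 2 * (\<Sum>p\<in>{p \<in> D \<times> D. 2 ^ i \<le> r (snd p - fst p)}. 1) \<le> root 4 X / t"
      by (simp add: g_def u_def \<sigma>_def)
  qed (auto simp: rK)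
  finally have "T * t \<le> 4 * k * root 4 X" using pos by (simp add: k_def field_simps)
  hence "(T * t) ^ 4 \<le> (4 * k * root 4 X) ^ 4" using T0 pos by (intro power_mono) auto
  also have "\<dots> = 256 * k ^ 4 * X" using X0 by (simp add: power_mult_distrib)
  finally have i5: "(T * t) ^ 4 \<le> 256 * k ^ 4 * X" .
  have "(d ^ 3 * t ^ 4) ^ 2 \<le> (n ^ 3 * triangles) ^ 2" using d0 by (intro power_mono i3) auto
  also have "\<dots> = n ^ 6 * triangles\<^sup>2" by (simp add: power_mult_distrib flip: power_mult)
  also have "\<dots> \<le> n ^ 6 * (1296 * k * n ^ 3 * T)" by (intro mult_left_mono i4) auto
  finally have i6: "(d ^ 3 * t ^ 4) ^ 2 \<le> 1296 * k * n ^ 9 * T"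
    by (simp add: eval_nat_numeral algebra_simps)
  \<comment> \<open>The extra factor \<open>t ^ 4\<close> completes \<open>T ^ 4\<close> to the left
    side of \<open>i5\<close>, which eliminates \<open>T\<close>.\<close>
  have "d ^ 24 * t ^ 36 = ((d ^ 3 * t ^ 4) ^ 2) ^ 4 * t ^ 4"
    by (simp add: power_mult_distrib flip: power_mult power_add)
  also have "\<dots> \<le> (1296 * k * n ^ 9 * T) ^ 4 * t ^ 4" by (intro mult_right_mono power_mono i6) auto
  also have "\<dots> = 1296 ^ 4 * k ^ 4 * n ^ 36 * (T * t) ^ 4"
    by (simp add: power_mult_distrib flip: power_mult)
  also have "\<dots> \<le> 1296 ^ 4 * k ^ 4 * n ^ 36 * (256 * k ^ 4 * X)" by (intro mult_left_mono i5) auto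
  also have "\<dots> = d ^ 3 * (1296 ^ 4 * 256 * 2592 ^ 2 * 162 ^ 2 * k ^ 12 * n ^ 46 * e)"
  proof -
    have "X = 2592 ^ 2 * 162 ^ 2 * k ^ 4 * n ^ 10 * d ^ 3 * e"
      by (simp add: X_def power_mult_distrib flip: power_mult power_add)
    hence "1296 ^ 4 * k ^ 4 * n ^ 36 * (256 * k ^ 4 * X) =
        d ^ 3 * (1296 ^ 4 * 256 * 2592 ^ 2 * 162 ^ 2 * (k ^ 4 * k ^ 4 * k ^ 4) * (n ^ 36 * n ^ 10) * e)"
      by (simp only: mult_ac)
    thus ?thesis by (simp flip: power_add)
  qed
  finally have "d ^ 3 * (d ^ 21 * t ^ 36) \<le> d ^ 3 * (1296 ^ 4 * 256 * 2592 ^ 2 * 162 ^ 2 * k ^ 12 * n ^ 46 * e)"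
    by (simp flip: power_add mult.assoc)
  hence i7: "d ^ 21 * t ^ 36 \<le> 1296 ^ 4 * 256 * 2592 ^ 2 * 162 ^ 2 * k ^ 12 * n ^ 46 * e"
    by (rule mult_left_le_imp_le) (use d0 in simp)
  \<comment> \<open>Six copies of \<open>i2\<close> complete \<open>d ^ 21 * t ^ 36\<close> to a
    power of \<open>d * t ^ 2\<close>, the quantity bounded below by the energy.\<close>
  have "(e / (8 * k)) ^ 27 \<le> (d * t ^ 2) ^ 27" using e0 pos by (intro power_mono i1) auto
  also have "\<dots> = (d ^ 21 * t ^ 36) * (d * t ^ 3) ^ 6"
  proof -
    have "d ^ 21 * d ^ 6 = d ^ 27" "t ^ 36 * t ^ 18 = t ^ 54" by (simp_all flip: power_add)
    thus ?thesis by (simp add: power_mult_distrib mult_ac flip: power_mult)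
  qed
  also have "\<dots> \<le> (1296 ^ 4 * 256 * 2592 ^ 2 * 162 ^ 2 * k ^ 12 * n ^ 46 * e) * (162 * n ^ 3) ^ 6"
    using pos d0 e0 by (intro mult_mono i7 power_mono i2) auto
  also have "\<dots> = (1296 ^ 4 * 256 * 2592 ^ 2 * 162 ^ 8) * k ^ 12 * n ^ 64 * e"
  proof -
    have "n ^ 46 * n ^ 18 = n ^ 64" by (simp flip: power_add)
    thus ?thesis by (simp add: power_mult_distrib mult_ac flip: power_mult)
  qed
  finally have "e ^ 27 \<le> (1296 ^ 4 * 256 * 2592 ^ 2 * 162 ^ 8) * k ^ 12 * n ^ 64 * e * (8 * k) ^ 27"
    using pos by (simp add: power_divide pos_divide_le_eq)
  also have "\<dots> = e * ((1296 ^ 4 * 256 * 2592 ^ 2 * 162 ^ 8 * 8 ^ 27) * k ^ 39 * n ^ 64)"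
  proof -
    have "k ^ 12 * k ^ 27 = k ^ 39" by (simp flip: power_add)
    thus ?thesis by (simp add: power_mult_distrib mult_ac)
  qed
  finally have "e * e ^ 26 \<le> e * ((1296 ^ 4 * 256 * 2592 ^ 2 * 162 ^ 8 * 8 ^ 27) * k ^ 39 * n ^ 64)"
    by (simp flip: power_Suc)
  hence "e ^ 26 \<le> (1296 ^ 4 * 256 * 2592 ^ 2 * 162 ^ 8 * 8 ^ 27) * k ^ 39 * n ^ 64"
    by (rule mult_left_le_imp_le) (use e0 in simp)
  also have "\<dots> \<le> 2 ^ 212 * k ^ 39 * n ^ 64"
    using pos by (intro mult_right_mono) auto
  finally show ?thesis by (simp add: e_def k_def n_def)
qed

section \<open>Prime dilates of trigonometric polynomials\<close>

text \<open>The reciprocals 1 / ((n + 1) (n choose k)) form Leibniz's harmonic triangle: each entry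
  is the difference of its neighbours in the preceding column. Hence all of them are integer
  combinations of the unit fractions 1 / i with i \<le> M.\<close>

lemma leibniz_harmonic_triangle:
  fixes D :: real
  assumes "\<And>i. 1 \<le> i \<Longrightarrow> i \<le> M \<Longrightarrow> D / real i \<in> \<int>" "n < M" "k \<le> n"
  shows "D / (real (n + 1) * real (n choose k)) \<in> \<int>"
  using assms(2,3)
proof (induction k arbitrary: n)
  case 0
  thus ?case using assms(1)[of "n + 1"] by simp
next
  case (Suc k)
  then obtain m where m: "n = Suc m" by (cases n) auto
  have km: "k \<le> m" using Suc.prems m by simp
  define x y z where "x = real (n choose k)" and "y = real (n choose Suc k)" and "z = real (m choose k)"
  have pos: "x > 0" "y > 0" "z > 0" using Suc.prems km by (simp_all add: x_def y_def z_def)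
  have "Suc k * (Suc m choose Suc k) = Suc m * (m choose k)" by (rule Suc_times_binomial)
  hence 1: "real (Suc k) * y = real n * z" unfolding y_def z_def m by (metis of_nat_mult)
  have "Suc k * (Suc n choose Suc k) = Suc n * (n choose k)" by (rule Suc_times_binomial)
  hence "real (Suc k) * real (Suc n choose Suc k) = real (Suc n) * x"
    unfolding x_def by (metis of_nat_mult)
  hence 2: "real (Suc k) * (x + y) = real (n + 1) * x" by (simp add: x_def y_def)
  have "real n * z * (x + y) = real (n + 1) * x * y" using 1 2 by algebra
  hence "1 / (real (n + 1) * y) = 1 / (real n * z) - 1 / (real (n + 1) * x)"
    using pos m by (simp add: divide_simps) (simp add: algebra_simps)
  hence "D * (1 / (real (n + 1) * y)) = D * (1 / (real n * z)) - D * (1 / (real (n + 1) * x))"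
    by (simp only: right_diff_distrib)
  hence "D / (real (n + 1) * y) = D / (real n * z) - D / (real (n + 1) * x)" by simp
  moreover have "D / (real n * z) \<in> \<int>"
    using Suc.IH[of m] Suc.prems km m by (simp add: z_def)
  moreover have "D / (real (n + 1) * x) \<in> \<int>"
    using Suc.IH[of n] Suc.prems by (simp add: x_def)
  ultimately show ?case by (simp add: y_def)
qed

text \<open>The least common multiple of \<open>1, ..., M\<close> is at most \<open>M\<close> to the number of primes, and by the previous
  lemma it is a multiple of \<open>M\<close> times the central binomial coefficient.\<close>

lemma prime_count_lower_bound:
  assumes M: "M \<ge> 1"
  shows "2 ^ (M - 1) \<le> M ^ card {p::nat. prime p \<and> p \<le> M}"
proof -
  define P where "P = {p::nat. prime p \<and> p \<le> M}"
  have finP: "finite P" by (simp add: P_def)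
  define e where "e p = Max {k. p ^ k \<le> M}" for p
  have e: "p ^ e p \<le> M \<and> (\<forall>k. p ^ k \<le> M \<longrightarrow> k \<le> e p)" if "p \<in> P" for p
  proof -
    have p2: "p \<ge> 2" using that prime_ge_2_nat by (auto simp: P_def)
    have "{k. p ^ k \<le> M} \<subseteq> {..M}"
    proof
      fix k assume "k \<in> {k. p ^ k \<le> M}"
      hence "p ^ k \<le> M" by simp
      moreover have "k < p ^ k" using p2 by (simp add: power_gt_expt)
      ultimately show "k \<in> {..M}" by simp
    qed
    hence fin: "finite {k. p ^ k \<le> M}" by (rule finite_subset) simp
    moreover have "{k. p ^ k \<le> M} \<noteq> {}" using M by (auto intro: exI[of _ 0])
    ultimately have "e p \<in> {k. p ^ k \<le> M}" unfolding e_def by (rule Max_in)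
    thus ?thesis using Max_ge[OF fin] by (simp add: e_def)
  qed
  define D where "D = (\<Prod>p\<in>P. p ^ e p)"
  have D0: "D > 0" unfolding D_def P_def by (intro prod_pos) (auto simp: prime_gt_0_nat)
  have dvd: "i dvd D" if i: "1 \<le> i" "i \<le> M" for i
  proof -
    have "i = (\<Prod>p\<in>prime_factors i. p ^ multiplicity p i)"
      using i by (intro prime_factorization_nat) auto
    also have "\<dots> dvd D" unfolding D_def
    proof (rule prod_dvd_prod_subset2)
      show "prime_factors i \<subseteq> P"
        using i by (auto simp: P_def prime_factors_dvd intro: le_trans[OF dvd_imp_le])
      fix p assume p: "p \<in> prime_factors i"
      hence pP: "p \<in> P" using \<open>prime_factors i \<subseteq> P\<close> by auto
      have "p ^ multiplicity p i \<le> i" using i by (intro dvd_imp_le multiplicity_dvd) auto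
      hence "multiplicity p i \<le> e p" using e[OF pP] i by simp
      thus "p ^ multiplicity p i dvd p ^ e p" by (rule le_imp_power_dvd)
    qed (rule finP)
    finally show ?thesis .
  qed
  define n where "n = M - 1"
  have n: "Suc n = M" using M by (simp add: n_def)
  have "real D / (real (n + 1) * real (n choose (n div 2))) \<in> \<int>"
  proof (rule leibniz_harmonic_triangle[of M])
    fix i assume "1 \<le> i" "i \<le> M"
    then obtain c where "D = i * c" using dvd by (auto elim: dvdE)
    thus "real D / real i \<in> \<int>" using \<open>1 \<le> i\<close> by simp
  qed (use n in auto)
  then obtain z where z: "real D / (real (n + 1) * real (n choose (n div 2))) = of_int z" by (auto elim: Ints_cases)
  have p0: "real (n + 1) * real (n choose (n div 2)) > 0" by simp
  have "real_of_int z > 0" unfolding z[symmetric] using D0 p0 by (intro divide_pos_pos) auto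
  hence "real_of_int z \<ge> 1" by simp
  hence "real (n + 1) * real (n choose (n div 2)) \<le> real D"
    using p0 unfolding z[symmetric] by (simp add: pos_le_divide_eq)
  hence "real ((n + 1) * (n choose (n div 2))) \<le> real D" by (simp only: of_nat_mult)
  hence 1: "(n + 1) * (n choose (n div 2)) \<le> D" by (simp only: of_nat_le_iff)
  have "2 ^ n = (\<Sum>k\<le>n. n choose k)" by (simp add: choose_row_sum)
  also have "\<dots> \<le> (\<Sum>k\<le>n. n choose (n div 2))" by (intro sum_mono binomial_maximum)
  also have "\<dots> = (n + 1) * (n choose (n div 2))" by simp
  also note 1
  also have "D \<le> (\<Prod>p\<in>P. M)" unfolding D_def using e by (intro prod_mono) auto
  also have "\<dots> = M ^ card P" by simp
  finally show ?thesis by (simp add: n_def P_def)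
qed

text \<open>The product of distinct primes dividing m is itself a divisor of m, and at least 2 to
  the power of their number.\<close>

lemma card_prime_divisors_le:
  fixes m :: int
  assumes "finite P" "\<And>p. p \<in> P \<Longrightarrow> prime p" "m \<noteq> 0" "\<bar>m\<bar> \<le> int B"
  shows "real (card {p \<in> P. int p dvd m}) \<le> log 2 (real B)"
proof -
  define S where "S = {p \<in> P. int p dvd m}"
  have "(\<Prod>p\<in>S. p) dvd (\<Prod>p\<in>prime_factors (nat \<bar>m\<bar>). p ^ multiplicity p (nat \<bar>m\<bar>))"
  proof (rule prod_dvd_prod_subset2)
    show sub: "S \<subseteq> prime_factors (nat \<bar>m\<bar>)"
      using assms by (auto simp: S_def prime_factors_dvd nat_abs_dvd_iff dvd_nat_abs_iff)
    fix p assume "p \<in> S"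
    hence "multiplicity p (nat \<bar>m\<bar>) > 0" using sub by (auto simp: prime_factors_multiplicity)
    thus "p dvd p ^ multiplicity p (nat \<bar>m\<bar>)" by (simp add: dvd_power)
  qed auto
  hence "(\<Prod>p\<in>S. p) dvd nat \<bar>m\<bar>"
    using assms by (subst prime_factorization_nat) auto
  hence "(\<Prod>p\<in>S. p) \<le> nat \<bar>m\<bar>" using assms by (intro dvd_imp_le) auto
  moreover have "(\<Prod>p\<in>S. 2) \<le> (\<Prod>p\<in>S. p)"
    using assms prime_ge_2_nat by (intro prod_mono) (auto simp: S_def)
  ultimately have "2 ^ card S \<le> B" using assms by simp
  hence "real (2 ^ card S) \<le> real B" by (rule of_nat_mono)
  hence "2 powr real (card S) \<le> real B" by (simp add: powr_realpow)
  moreover have "B > 0" using assms by simp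
  ultimately show ?thesis unfolding S_def by (simp add: le_log_iff)
qed

text \<open>Bernstein's argument: the binomial law has variance x (1 - x) / n \<le> 1 / (4 n). The
  inequality d \<le> 1 / (4 s) + s d^2 replaces Cauchy-Schwarz for the mean deviation, and n = s^2
  makes its optimal parameter an integer.\<close>

lemma Bernstein_Lipschitz_error:
  fixes \<phi> :: "real \<Rightarrow> real"
  assumes x: "0 \<le> x" "x \<le> 1" and s: "s > 0" and n: "n = s\<^sup>2" and C: "C \<ge> 0"
    and lip: "\<And>a b. a \<in> {0..1} \<Longrightarrow> b \<in> {0..1} \<Longrightarrow> \<bar>\<phi> a - \<phi> b\<bar> \<le> C * \<bar>a - b\<bar>"
  shows "\<bar>\<phi> x - (\<Sum>k\<le>n. \<phi> (real k / real n) * Bernstein n k x)\<bar> \<le> C / (2 * real s)"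
proof -
  have n0: "real n > 0" using s n by simp
  have var: "(\<Sum>k\<le>n. (real k / real n - x)\<^sup>2 * Bernstein n k x) = x * (1 - x) / real n"
  proof -
    have "(\<Sum>k\<le>n. (real k / real n - x)\<^sup>2 * Bernstein n k x) =
      (\<Sum>k\<le>n. (1 / (real n)\<^sup>2) * (real k * (real k - 1) * Bernstein n k x) +
         (1 / (real n)\<^sup>2 - 2 * x / real n) * (real k * Bernstein n k x) + x\<^sup>2 * Bernstein n k x)"
      using n0 by (intro sum.cong refl) (simp add: field_simps power2_eq_square)
    also have "\<dots> = (1 / (real n)\<^sup>2) * (real n * (real n - 1) * x\<^sup>2) +
         (1 / (real n)\<^sup>2 - 2 * x / real n) * (real n * x) + x\<^sup>2"
      by (simp only: sum.distrib sum_distrib_left[symmetric] sum_k_Bernstein sum_kk_Bernstein sum_Bernstein mult_1_right)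
    also have "\<dots> = x * (1 - x) / real n" using n0 by (simp add: field_simps power2_eq_square)
    finally show ?thesis .
  qed
  have "x * (1 - x) \<le> 1 / 4"
    using zero_le_power2[of "x - 1/2"] by (simp add: power2_eq_square algebra_simps)
  hence var': "real s * (x * (1 - x) / real n) \<le> 1 / (4 * real s)"
  proof -
    have "real s * (x * (1 - x) / real n) = x * (1 - x) / real s"
      using s n by (simp add: power2_eq_square)
    also have "\<dots> \<le> (1 / 4) / real s"
      using \<open>x * (1 - x) \<le> 1 / 4\<close> by (intro divide_right_mono) auto
    finally show ?thesis by simp
  qed
  have pw: "\<bar>\<phi> x - \<phi> (real k / real n)\<bar> \<le> C * (1 / (4 * real s) + real s * (real k / real n - x)\<^sup>2)"
    if k: "k \<le> n" for k
  proof -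
    define d where "d = \<bar>real k / real n - x\<bar>"
    have "0 \<le> (2 * real s * d - 1)\<^sup>2 / (4 * real s)" using s by simp
    hence "d \<le> 1 / (4 * real s) + real s * d\<^sup>2"
      using s by (simp add: field_simps power2_eq_square)
    hence "C * d \<le> C * (1 / (4 * real s) + real s * (real k / real n - x)\<^sup>2)"
      using C by (intro mult_left_mono) (auto simp: d_def)
    moreover have "\<bar>\<phi> x - \<phi> (real k / real n)\<bar> \<le> C * \<bar>x - real k / real n\<bar>"
      using x k n0 by (intro lip) auto
    ultimately show ?thesis by (simp add: d_def abs_minus_commute)
  qed
  have "\<phi> x - (\<Sum>k\<le>n. \<phi> (real k / real n) * Bernstein n k x) =
     (\<Sum>k\<le>n. (\<phi> x - \<phi> (real k / real n)) * Bernstein n k x)"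
    by (simp add: left_diff_distrib sum_subtractf flip: sum_distrib_left)
  also have "\<bar>\<dots>\<bar> \<le> (\<Sum>k\<le>n. C * (1 / (4 * real s) + real s * (real k / real n - x)\<^sup>2) * Bernstein n k x)"
    by (rule order_trans[OF sum_abs], rule sum_mono)
      (use x pw in \<open>auto simp: abs_mult Bernstein_nonneg intro!: mult_right_mono\<close>)
  also have "\<dots> = (\<Sum>k\<le>n. (C / (4 * real s)) * Bernstein n k x + C * real s * ((real k / real n - x)\<^sup>2 * Bernstein n k x))"
    by (intro sum.cong refl) (simp add: algebra_simps)
  also have "\<dots> = C / (4 * real s) + C * (real s * (x * (1 - x) / real n))"
    by (simp only: sum.distrib sum_distrib_left[symmetric] var sum_Bernstein mult_1_right mult.assoc)
  also have "\<dots> \<le> C / (4 * real s) + C * (1 / (4 * real s))"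
    by (intro add_left_mono mult_left_mono var' C)
  finally show ?thesis by simp
qed

section \<open>Fourier analysis on a unit interval\<close>

text \<open>A probability measure on one full period of the exponentials. The left end is free
  because the real line is later covered by unit intervals.\<close>

definition unit_at :: "real \<Rightarrow> real measure" where
  "unit_at u = restrict_space lborel {u..u + 1}"

lemma space_unit_at [simp]: "space (unit_at u) = {u..u + 1}"
  by (simp add: unit_at_def)

lemma sets_unit_at_Collect:
  assumes "Measurable.pred borel P"
  shows "{x \<in> {u..u + 1}. P x} \<in> sets (unit_at u)"
proof -
  have "{x. P x} \<in> sets borel" using assms by simp
  hence "{u..u+1} \<inter> {x. P x} \<in> sets (unit_at u)"
    by (auto simp: unit_at_def sets_restrict_space)
  thus ?thesis by (simp add: Int_def)
qed

lemma emeasure_unit_at: "emeasure (unit_at u) {u..u + 1} = 1"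
  by (simp add: unit_at_def emeasure_restrict_space)

lemma finite_measure_unit_at: "finite_measure (unit_at u)"
  by (rule finite_measureI) (simp add: emeasure_unit_at)

lemma integrable_unit_at:
  fixes f :: "real \<Rightarrow> 'a :: {banach, second_countable_topology}"
  assumes "continuous_on UNIV f"
  shows "integrable (unit_at u) f"
  unfolding unit_at_def
  by (subst integrable_restrict_space)
    (auto intro!: borel_integrable_compact continuous_on_subset[OF assms])

definition e :: "int \<Rightarrow> real \<Rightarrow> complex" where
  "e k x = cis (2 * pi * of_int k * x)"

lemma continuous_e [continuous_intros]: "continuous_on A g \<Longrightarrow> continuous_on A (\<lambda>x. e k (g x))"
  unfolding e_def by (intro continuous_intros)

lemma e_0 [simp]: "e 0 x = 1" and norm_e [simp]: "norm (e k x) = 1"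
  by (simp_all add: e_def)

lemma e_add: "e (k + l) x = e k x * e l x"
  by (simp add: e_def cis_mult algebra_simps)

lemma e_dilate: "e k (of_int p * x) = e (p * k) x"
  by (simp add: e_def mult_ac)

lemma cnj_e: "cnj (e k x) = e (- k) x"
  by (simp add: e_def cis_cnj)

lemma integral_e: "integral\<^sup>L (unit_at u) (e k) = (if k = 0 then 1 else 0)"
proof (cases "k = 0")
  case True
  moreover have "e 0 = (\<lambda>_. 1)" by (rule ext) simp
  ultimately show ?thesis by (simp add: measure_def emeasure_unit_at)
next
  case False
  define w where "w = 2 * pi * of_int k"
  have w: "w \<noteq> 0" using False by (simp add: w_def)
  define F where "F x = cis (w * x) / (\<i> * of_real w)" for x
  have cis: "cis (w * x) = exp (\<i> * (of_real w * of_real x))" for x by (simp add: cis_conv_exp)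
  have "has_bochner_integral lborel (\<lambda>x. indicator {u..u+1} x *\<^sub>R e k x) (F (u + 1) - F u)"
  proof (rule has_bochner_integral_FTC_Icc)
    fix x assume "u \<le> x" "x \<le> u + 1"
    have "((\<lambda>z. exp (\<i> * (of_real w * z)) / (\<i> * of_real w)) has_field_derivative cis (w * x)) (at (of_real x))"
      using w by (auto intro!: derivative_eq_intros simp: cis complex_eq_iff)
    from has_vector_derivative_real_field[OF this]
    have "(F has_vector_derivative cis (w * x)) (at x)" by (simp add: F_def[abs_def] cis)
    thus "(F has_vector_derivative e k x) (at x within {u..u+1})"
      by (simp add: e_def w_def has_vector_derivative_at_within)
  qed (auto intro!: continuous_intros)
  moreover have "F (u + 1) = F u"
  proof -
    have "cis (w * (u + 1)) = cis (w * u) * cis w" by (simp add: cis_mult algebra_simps)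
    also have "cis w = 1" unfolding w_def by (metis cis_multiple_2pi Ints_of_int mult.commute mult.left_commute)
    finally show ?thesis by (simp add: F_def)
  qed
  ultimately have "integral\<^sup>L lborel (\<lambda>x. indicator {u..u+1} x *\<^sub>R e k x) = 0"
    by (simp add: has_bochner_integral_iff)
  thus ?thesis using False unfolding unit_at_def by (subst integral_restrict_space) auto
qed

lemma integral_trig_sum:
  assumes "finite S"
  shows "integral\<^sup>L (unit_at u) (\<lambda>x. \<Sum>k\<in>S. c k * e k x) = (if 0 \<in> S then c 0 else 0)"
proof -
  have "integral\<^sup>L (unit_at u) (\<lambda>x. \<Sum>k\<in>S. c k * e k x) = (\<Sum>k\<in>S. c k * integral\<^sup>L (unit_at u) (e k))"
    by (subst Bochner_Integration.integral_sum)
      (auto intro!: integrable_unit_at continuous_intros)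
  also have "\<dots> = (\<Sum>k\<in>S. if k = 0 then c k else 0)"
    by (intro sum.cong refl) (simp add: integral_e)
  also have "\<dots> = (if 0 \<in> S then c 0 else 0)" using assms by simp
  finally show ?thesis .
qed

lemma parseval:
  assumes "finite S"
  shows "(\<integral>x. (norm (\<Sum>k\<in>S. c k * e k x))\<^sup>2 \<partial>unit_at u) = (\<Sum>k\<in>S. (norm (c k))\<^sup>2)"
proof -
  have "complex_of_real (\<integral>x. (norm (\<Sum>k\<in>S. c k * e k x))\<^sup>2 \<partial>unit_at u) =
     (\<integral>x. complex_of_real ((norm (\<Sum>k\<in>S. c k * e k x))\<^sup>2) \<partial>unit_at u)"
    by (rule integral_complex_of_real[symmetric])
  also have "\<dots> = (\<integral>x. (\<Sum>k\<in>S. \<Sum>l\<in>S. c k * cnj (c l) * e (k - l) x) \<partial>unit_at u)"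
    by (intro Bochner_Integration.integral_cong refl)
      (simp add: complex_norm_square sum_product cnj_e e_add mult_ac diff_conv_add_uminus del: add_uminus_conv_diff of_real_power)
  also have "\<dots> = (\<Sum>k\<in>S. \<Sum>l\<in>S. c k * cnj (c l) * integral\<^sup>L (unit_at u) (e (k - l)))"
    by (subst Bochner_Integration.integral_sum, (auto intro!: integrable_unit_at continuous_intros)[1],
        subst Bochner_Integration.integral_sum)
      (auto intro!: integrable_unit_at continuous_intros)
  also have "\<dots> = (\<Sum>k\<in>S. \<Sum>l\<in>S. if l = k then c k * cnj (c k) else 0)"
    by (intro sum.cong refl) (auto simp: integral_e)
  also have "\<dots> = complex_of_real (\<Sum>k\<in>S. (norm (c k))\<^sup>2)"
    using assms by (simp add: complex_norm_square del: of_real_power)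
  finally show ?thesis by (simp only: of_real_eq_iff)
qed

text \<open>A frequency \<open>m\<close> of the sum arises as \<open>p * k\<close> for at most \<open>log 2 \<bar>m\<bar>\<close> primes \<open>p\<close>, so the dilates are
  almost orthogonal. This is where a bound on the growth of the sequence is needed.\<close>

lemma prime_dilates_variance:
  fixes K :: nat and c :: "int \<Rightarrow> complex"
  defines "q \<equiv> \<lambda>x. \<Sum>k\<in>{-int K..int K}. c k * e k x"
  assumes P: "finite P" "\<And>p. p \<in> P \<Longrightarrow> prime p" "\<And>p. p \<in> P \<Longrightarrow> p \<le> Q"
  shows "(\<integral>x. (norm (\<Sum>p\<in>P. q (real p * x) - c 0))\<^sup>2 \<partial>unit_at u)
     \<le> log 2 (real (Q * K)) * real (card P) * (\<Sum>k\<in>{-int K..int K}. (norm (c k))\<^sup>2)"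
proof (cases "P = {} \<or> K = 0")
  case True
  \<comment> \<open>For K = 0 only the constant term is present and it cancels; the right side
    vanishes too, as \<open>log 2 0 = 0\<close>.\<close>
  thus ?thesis by (auto simp: q_def log_def)
next
  case False
  define S where "S = {-int K..int K} - {0}"
  define R where "R = {-int (Q * K)..int (Q * K)} - {0}"
  have fin: "finite S" "finite R" by (auto simp: S_def R_def)
  define L where "L = log 2 (real (Q * K))"
  \<comment> \<open>The coefficient of \<open>e m x\<close> in the dilate by p. At most one k
    contributes, so its squared modulus is the corresponding sum \<open>h p m\<close>.\<close>
  define g where "g p m = (\<Sum>k\<in>S. if int p * k = m then c k else 0)" for p m
  define h where "h p m = (\<Sum>k\<in>S. if int p * k = m then (norm (c k))\<^sup>2 else 0)" for p m
  have pos: "p > 0" if "p \<in> P" for p using P(2)[OF that] by (rule prime_gt_0_nat)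
  have mem: "int p * k \<in> R" if "p \<in> P" "k \<in> S" for p k
  proof -
    have "\<bar>int p * k\<bar> \<le> int Q * int K"
      unfolding abs_mult using P(3)[OF that(1)] that(2) by (intro mult_mono) (auto simp: S_def)
    thus ?thesis using pos[OF that(1)] that(2) by (auto simp: R_def S_def)
  qed
  have L0: "L \<ge> 0"
  proof -
    obtain p where "p \<in> P" using False by auto
    hence "Q > 0" using pos P(3) by (metis gr0I le_zero_eq)
    hence "Q * K \<ge> 1" using False by simp
    hence "real (Q * K) \<ge> 1" by linarith
    thus ?thesis unfolding L_def by simp
  qed
  have gh: "(norm (g p m))\<^sup>2 = h p m \<and> (g p m \<noteq> 0 \<longrightarrow> int p dvd m)" if "p \<in> P" for p m
  proof (cases "\<exists>k\<in>S. int p * k = m")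
    case True
    then obtain k where k: "k \<in> S" "int p * k = m" by auto
    hence *: "int p * k' = m \<longleftrightarrow> k' = k" for k' using pos[OF that] by auto
    show ?thesis unfolding g_def h_def * using k fin by (auto simp: sum.delta')
  next
    case False
    hence "g p m = 0" "h p m = 0" by (auto simp: g_def h_def intro!: sum.neutral)
    thus ?thesis by simp
  qed
  have expand: "(\<Sum>p\<in>P. q (real p * x) - c 0) = (\<Sum>m\<in>R. (\<Sum>p\<in>P. g p m) * e m x)" for x
  proof -
    have "q y - c 0 = (\<Sum>k\<in>S. c k * e k y)" for y
      unfolding q_def S_def by (subst sum.remove[of _ 0]) auto
    hence "(\<Sum>p\<in>P. q (real p * x) - c 0) = (\<Sum>p\<in>P. \<Sum>k\<in>S. c k * e (int p * k) x)"
      using e_dilate[of _ "int _" x] by simp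
    also have "\<dots> = (\<Sum>p\<in>P. \<Sum>k\<in>S. \<Sum>m\<in>R. (if int p * k = m then c k else 0) * e m x)"
    proof (intro sum.cong refl)
      fix p k assume "p \<in> P" "k \<in> S"
      have "(\<Sum>m\<in>R. (if int p * k = m then c k else 0) * e m x) = (\<Sum>m\<in>R. if m = int p * k then c k * e m x else 0)"
        by (intro sum.cong refl) auto
      also have "\<dots> = c k * e (int p * k) x"
        using mem[OF \<open>p \<in> P\<close> \<open>k \<in> S\<close>] fin by simp
      finally show "c k * e (int p * k) x = (\<Sum>m\<in>R. (if int p * k = m then c k else 0) * e m x)" by simp
    qed
    also have "\<dots> = (\<Sum>p\<in>P. \<Sum>m\<in>R. \<Sum>k\<in>S. (if int p * k = m then c k else 0) * e m x)"
      by (intro sum.cong refl sum.swap)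
    also have "\<dots> = (\<Sum>m\<in>R. \<Sum>p\<in>P. \<Sum>k\<in>S. (if int p * k = m then c k else 0) * e m x)"
      by (rule sum.swap)
    also have "\<dots> = (\<Sum>m\<in>R. (\<Sum>p\<in>P. g p m) * e m x)"
      by (simp only: g_def sum_distrib_right)
    finally show ?thesis .
  qed
  have bound: "(norm (\<Sum>p\<in>P. g p m))\<^sup>2 \<le> L * (\<Sum>p\<in>P. h p m)" if m: "m \<in> R" for m
  proof -
    define Pm where "Pm = {p \<in> P. int p dvd m}"
    have cardPm: "real (card Pm) \<le> L"
      unfolding Pm_def L_def by (rule card_prime_divisors_le) (use P m in \<open>auto simp: R_def\<close>)
    have "(\<Sum>p\<in>P. g p m) = (\<Sum>p\<in>Pm. g p m)"
      using gh P by (intro sum.mono_neutral_right) (auto simp: Pm_def)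
    also have "norm \<dots> \<le> (\<Sum>p\<in>Pm. norm (g p m))" by (rule norm_sum)
    finally have "(norm (\<Sum>p\<in>P. g p m))\<^sup>2 \<le> (\<Sum>p\<in>Pm. norm (g p m))\<^sup>2"
      by (intro power_mono) auto
    \<comment> \<open>Cauchy-Schwarz over the at most \<open>L\<close> primes dividing m; over all
      of \<open>P\<close> it would cost a factor \<open>card P\<close> and destroy the gain from
      averaging.\<close>
    also have "\<dots> \<le> (\<Sum>p\<in>Pm. (norm (g p m))\<^sup>2) * real (card Pm)"
      by (rule sum_squared_le_sum_of_squares)
    also have "\<dots> \<le> (\<Sum>p\<in>P. (norm (g p m))\<^sup>2) * L"
      using P by (intro mult_mono cardPm sum_mono2) (auto simp: Pm_def intro: sum_nonneg)
    also have "\<dots> = L * (\<Sum>p\<in>P. h p m)" using gh by simp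
    finally show ?thesis .
  qed
  have "(\<integral>x. (norm (\<Sum>p\<in>P. q (real p * x) - c 0))\<^sup>2 \<partial>unit_at u) = (\<Sum>m\<in>R. (norm (\<Sum>p\<in>P. g p m))\<^sup>2)"
    unfolding expand by (rule parseval[OF fin(2)])
  also have "\<dots> \<le> (\<Sum>m\<in>R. L * (\<Sum>p\<in>P. h p m))" by (intro sum_mono bound)
  also have "\<dots> = L * (\<Sum>p\<in>P. \<Sum>m\<in>R. h p m)" by (subst sum.swap) (simp add: sum_distrib_left)
  also have "\<dots> = L * (\<Sum>p\<in>P. \<Sum>k\<in>S. (norm (c k))\<^sup>2)"
  proof (rule arg_cong2[of _ _ _ _ times], rule refl, rule sum.cong[OF refl])
    fix p assume p: "p \<in> P"
    have "(\<Sum>m\<in>R. h p m) = (\<Sum>k\<in>S. \<Sum>m\<in>R. if int p * k = m then (norm (c k))\<^sup>2 else 0)"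
      unfolding h_def by (rule sum.swap)
    also have "\<dots> = (\<Sum>k\<in>S. (norm (c k))\<^sup>2)"
      using mem[OF p] fin by (intro sum.cong refl) (simp add: sum.delta')
    finally show "(\<Sum>m\<in>R. h p m) = (\<Sum>k\<in>S. (norm (c k))\<^sup>2)" .
  qed
  also have "\<dots> = L * (real (card P) * (\<Sum>k\<in>S. (norm (c k))\<^sup>2))" by simp
  also have "\<dots> \<le> L * (real (card P) * (\<Sum>k\<in>{-int K..int K}. (norm (c k))\<^sup>2))"
    by (intro mult_left_mono L0 sum_mono2) (auto simp: S_def)
  finally show ?thesis by (simp add: L_def mult.assoc)
qed

section \<open>Trigonometric polynomials of bounded degree\<close>

definition trig_poly :: "nat \<Rightarrow> (real \<Rightarrow> complex) set" where
  "trig_poly K = {q. \<exists>c. \<forall>x. q x = (\<Sum>k\<in>{-int K..int K}. c k * e k x)}"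

lemma trig_poly_monomial:
  assumes "\<bar>k\<bar> \<le> int K"
  shows "(\<lambda>x. a * e k x) \<in> trig_poly K"
proof -
  have "a * e k x = (\<Sum>l\<in>{-int K..int K}. (if l = k then a else 0) * e l x)" for x
  proof -
    have "-int K \<le> k" "k \<le> int K" using assms by auto
    thus ?thesis by (simp add: if_distrib[of "\<lambda>z. z * _"] sum.delta cong: if_cong)
  qed
  thus ?thesis by (auto simp: trig_poly_def)
qed

lemma trig_poly_const: "(\<lambda>x. a) \<in> trig_poly K"
  using trig_poly_monomial[of 0 K a] by simp

lemma trig_poly_add:
  assumes "p \<in> trig_poly K" "q \<in> trig_poly K"
  shows "(\<lambda>x. p x + q x) \<in> trig_poly K"
proof -
  obtain c d where "\<And>x. p x = (\<Sum>k\<in>{-int K..int K}. c k * e k x)" "\<And>x. q x = (\<Sum>k\<in>{-int K..int K}. d k * e k x)"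
    using assms by (auto simp: trig_poly_def)
  hence "p x + q x = (\<Sum>k\<in>{-int K..int K}. (c k + d k) * e k x)" for x
    by (simp add: distrib_right sum.distrib)
  thus ?thesis unfolding trig_poly_def mem_Collect_eq
    by (intro exI[of _ "\<lambda>k. c k + d k"]) simp
qed

lemma trig_poly_sum:
  assumes "\<And>i. i \<in> I \<Longrightarrow> f i \<in> trig_poly K"
  shows "(\<lambda>x. \<Sum>i\<in>I. f i x) \<in> trig_poly K"
  using assms by (induction I rule: infinite_finite_induct) (auto intro: trig_poly_const trig_poly_add)

lemma trig_poly_mult:
  assumes "p \<in> trig_poly K" "q \<in> trig_poly L"
  shows "(\<lambda>x. p x * q x) \<in> trig_poly (K + L)"
proof -
  obtain c d where *: "\<And>x. p x = (\<Sum>k\<in>{-int K..int K}. c k * e k x)" "\<And>x. q x = (\<Sum>k\<in>{-int L..int L}. d k * e k x)"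
    using assms by (auto simp: trig_poly_def)
  have "(\<lambda>x. \<Sum>k\<in>{-int K..int K}. \<Sum>l\<in>{-int L..int L}. (c k * d l) * e (k + l) x) \<in> trig_poly (K + L)"
    by (intro trig_poly_sum trig_poly_monomial) auto
  also have "(\<lambda>x. \<Sum>k\<in>{-int K..int K}. \<Sum>l\<in>{-int L..int L}. (c k * d l) * e (k + l) x) = (\<lambda>x. p x * q x)"
    by (simp add: * sum_product e_add mult_ac)
  finally show ?thesis .
qed

lemma trig_poly_power:
  assumes "p \<in> trig_poly K"
  shows "(\<lambda>x. p x ^ n) \<in> trig_poly (n * K)"
proof (induction n)
  case (Suc n)
  from trig_poly_mult[OF assms this] show ?case by (simp add: add.commute)
qed (simp add: trig_poly_const)

lemma trig_poly_cnj:
  assumes "p \<in> trig_poly K"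
  shows "(\<lambda>x. cnj (p x)) \<in> trig_poly K"
proof -
  obtain c where *: "\<And>x. p x = (\<Sum>k\<in>{-int K..int K}. c k * e k x)"
    using assms by (auto simp: trig_poly_def)
  have "(\<lambda>x. \<Sum>k\<in>{-int K..int K}. cnj (c k) * e (- k) x) \<in> trig_poly K"
    by (intro trig_poly_sum trig_poly_monomial) auto
  also have "(\<lambda>x. \<Sum>k\<in>{-int K..int K}. cnj (c k) * e (- k) x) = (\<lambda>x. cnj (p x))"
    by (simp add: * cnj_e)
  finally show ?thesis .
qed

lemma trig_poly_continuous: "p \<in> trig_poly K \<Longrightarrow> continuous_on UNIV p"
proof -
  assume "p \<in> trig_poly K"
  then obtain c where "\<And>x. p x = (\<Sum>k\<in>{-int K..int K}. c k * e k x)"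
    by (auto simp: trig_poly_def)
  hence "p = (\<lambda>x. \<Sum>k\<in>{-int K..int K}. c k * e k x)" by blast
  thus ?thesis by (auto intro!: continuous_intros)
qed

text \<open>Each Bernstein polynomial is homogeneous of degree n in y and 1 - y, and both of these
  have degree at most K.\<close>

lemma trig_poly_Bernstein:
  assumes "(\<lambda>x. complex_of_real (y x)) \<in> trig_poly K"
  shows "(\<lambda>x. complex_of_real (\<Sum>k\<le>n. a k * Bernstein n k (y x))) \<in> trig_poly (n * K)"
proof -
  have 1: "(\<lambda>x. complex_of_real (1 - y x)) \<in> trig_poly K"
  proof -
    have "(\<lambda>x. 1 + (- 1) * complex_of_real (y x)) \<in> trig_poly (0 + K)"
      by (intro trig_poly_add trig_poly_const trig_poly_mult assms)
    thus ?thesis by simp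
  qed
  have "(\<lambda>x. \<Sum>k\<le>n. complex_of_real (a k * real (n choose k)) *
      (complex_of_real (y x) ^ k * complex_of_real (1 - y x) ^ (n - k))) \<in> trig_poly (n * K)"
  proof (rule trig_poly_sum)
    fix k assume k: "k \<in> {..n}"
    have "(\<lambda>x. complex_of_real (a k * real (n choose k)) *
      (complex_of_real (y x) ^ k * complex_of_real (1 - y x) ^ (n - k))) \<in> trig_poly (0 + (k * K + (n - k) * K))"
      by (intro trig_poly_mult trig_poly_const trig_poly_power assms 1)
    also have "0 + (k * K + (n - k) * K) = n * K"
      using k by (simp flip: add_mult_distrib)
    finally show "(\<lambda>x. complex_of_real (a k * real (n choose k)) *
      (complex_of_real (y x) ^ k * complex_of_real (1 - y x) ^ (n - k))) \<in> trig_poly (n * K)" .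
  qed
  also have "(\<lambda>x. \<Sum>k\<le>n. complex_of_real (a k * real (n choose k)) *
      (complex_of_real (y x) ^ k * complex_of_real (1 - y x) ^ (n - k))) =
     (\<lambda>x. complex_of_real (\<Sum>k\<le>n. a k * Bernstein n k (y x)))"
    by (simp add: Bernstein_def mult.assoc)
  finally show ?thesis .
qed

text \<open>The indicator of \<open>t \<le> norm (F x)\<close> is replaced by a Bernstein polynomial in \<open>(norm (F x))\<^sup>2\<close>, which is
  again a trigonometric polynomial of controlled degree, and Chebyshev's inequality is applied to
  the sum of its dilates.\<close>

lemma large_values_of_dilates:
  fixes F :: "real \<Rightarrow> complex" and t N u :: real
  assumes F: "F \<in> trig_poly B" and FN: "\<And>x. norm (F x) \<le> N" and t: "1 \<le> t" "t \<le> N"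
    and P: "finite P" "P \<noteq> {}" "\<And>p. p \<in> P \<Longrightarrow> prime p" "\<And>p. p \<in> P \<Longrightarrow> p \<le> Q"
  defines "m \<equiv> measure (unit_at u) {x \<in> {u..u + 1}. t \<le> norm (F x)}"
  assumes s: "s > 0" "4 * N\<^sup>2 \<le> m * real s"
  shows "measure (unit_at u) {x \<in> {u..u + 1}. \<forall>p\<in>P. norm (F (real p * x)) < t / 2}
     \<le> 3 * log 2 (real (Q * (2 * B * s\<^sup>2))) / (real (card P) * m)"
proof -
  interpret M: finite_measure "unit_at u" by (rule finite_measure_unit_at)
  \<comment> \<open>Bernstein polynomials live on the unit interval, hence the division by
    \<open>N\<^sup>2\<close>. The square makes \<open>y\<close> a trigonometric polynomial, namely a
    multiple of \<open>F x * cnj (F x)\<close>.\<close>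
  define y where "y x = (norm (F x))\<^sup>2 / N\<^sup>2" for x
  have N0: "N > 0" using t by simp
  have y01: "y x \<in> {0..1}" for x
    using N0 FN[of x] by (auto simp: y_def divide_le_eq power_mono)
  have contF: "continuous_on UNIV F" using F by (rule trig_poly_continuous)
  \<comment> \<open>A cutoff in terms of \<open>y\<close>: it is 0 where \<open>norm (F x)\<close>
    is at most t / 2 and 1 where it is at least t.\<close>
  define \<phi> where "\<phi> a = max 0 (min 1 ((4 * a * N\<^sup>2 / t\<^sup>2 - 1) / 3))" for a
  \<comment> \<open>The slope is \<open>4 * N\<^sup>2 / (3 * t\<^sup>2)\<close>, below this value
    since t \<ge> 1. With this choice the approximation error C / (2 s) is exactly \<eta>.\<close>
  define C where "C = 2 * N\<^sup>2"
  have lip: "\<bar>\<phi> a - \<phi> b\<bar> \<le> C * \<bar>a - b\<bar>" for a b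
  proof -
    have "\<bar>max 0 (min 1 a') - max 0 (min 1 b')\<bar> \<le> \<bar>a' - b'\<bar>" for a' b' :: real
      by (simp add: max_def min_def abs_if)
    hence "\<bar>\<phi> a - \<phi> b\<bar> \<le> \<bar>(4 * a * N\<^sup>2 / t\<^sup>2 - 1) / 3 - (4 * b * N\<^sup>2 / t\<^sup>2 - 1) / 3\<bar>"
      unfolding \<phi>_def by blast
    also have "\<dots> = \<bar>4 * N\<^sup>2 / (3 * t\<^sup>2) * (a - b)\<bar>"
      by (rule arg_cong[of _ _ abs]) (use t in \<open>simp add: field_simps\<close>)
    also have "\<dots> = 4 * N\<^sup>2 / (3 * t\<^sup>2) * \<bar>a - b\<bar>" by (simp add: abs_mult)
    also have "\<dots> \<le> C * \<bar>a - b\<bar>"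
    proof (intro mult_right_mono)
      have "t\<^sup>2 \<ge> 1" using t by simp
      hence "N\<^sup>2 * 4 \<le> N\<^sup>2 * (t\<^sup>2 * 6)" by (intro mult_left_mono) auto
      thus "4 * N\<^sup>2 / (3 * t\<^sup>2) \<le> C" using t by (simp add: C_def divide_le_eq mult_ac)
    qed auto
    finally show ?thesis .
  qed
  have phi01: "0 \<le> \<phi> a" "\<phi> a \<le> 1" for a by (auto simp: \<phi>_def)
  define n where "n = s\<^sup>2"
  define q where "q x = (\<Sum>k\<le>n. \<phi> (real k / real n) * Bernstein n k (y x))" for x
  define \<eta> where "\<eta> = N\<^sup>2 / real s"
  have err: "\<bar>\<phi> (y x) - q x\<bar> \<le> \<eta>" for x
    using Bernstein_Lipschitz_error[of "y x" s n C \<phi>] y01[of x] s lip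
    by (simp add: q_def n_def C_def \<eta>_def)
  have q01: "0 \<le> q x" "q x \<le> 1" for x
  proof -
    show "0 \<le> q x" unfolding q_def using y01[of x] phi01
      by (intro sum_nonneg mult_nonneg_nonneg Bernstein_nonneg) auto
    have "q x \<le> (\<Sum>k\<le>n. 1 * Bernstein n k (y x))" unfolding q_def using y01[of x] phi01
      by (intro sum_mono mult_right_mono Bernstein_nonneg) auto
    thus "q x \<le> 1" by simp
  qed
  have N2: "N\<^sup>2 > 0" using N0 by simp
  have m0: "m > 0"
  proof (rule ccontr)
    assume "\<not> m > 0"
    hence "m * real s \<le> 0" using s by (simp add: mult_nonpos_nonneg)
    thus False using s N2 by linarith
  qed
  have eta: "\<eta> \<le> m / 4" using s by (simp add: \<eta>_def field_simps)
  have ytp: "(\<lambda>x. complex_of_real (y x)) \<in> trig_poly (2 * B)"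
  proof -
    have "(\<lambda>x. complex_of_real (1 / N\<^sup>2) * (F x * cnj (F x))) \<in> trig_poly (0 + (B + B))"
      by (intro trig_poly_mult trig_poly_const F trig_poly_cnj)
    also have "(\<lambda>x. complex_of_real (1 / N\<^sup>2) * (F x * cnj (F x))) = (\<lambda>x. complex_of_real (y x))"
      by (simp add: y_def complex_norm_square[symmetric] del: of_real_power)
    finally show ?thesis by (simp add: mult_2)
  qed
  define K where "K = n * (2 * B)"
  have qtp: "(\<lambda>x. complex_of_real (q x)) \<in> trig_poly K"
    unfolding q_def K_def by (rule trig_poly_Bernstein[OF ytp])
  then obtain c where c: "\<And>x. complex_of_real (q x) = (\<Sum>k\<in>{-int K..int K}. c k * e k x)"
    by (auto simp: trig_poly_def)
  have contq: "continuous_on UNIV q"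
  proof -
    have "continuous_on UNIV (\<lambda>x. Re (complex_of_real (q x)))"
      by (intro continuous_intros trig_poly_continuous[OF qtp])
    thus ?thesis by simp
  qed
  define c0 where "c0 = integral\<^sup>L (unit_at u) q"
  have c0: "c 0 = complex_of_real c0"
  proof -
    have "complex_of_real c0 = (\<integral>x. (\<Sum>k\<in>{-int K..int K}. c k * e k x) \<partial>unit_at u)"
      unfolding c0_def c[symmetric] by simp
    thus ?thesis by (simp add: integral_trig_sum)
  qed
  \<comment> \<open>As \<open>q\<close> takes values between 0 and 1, its second moment is at most
    its mean. This makes the final bound of order 1 / (r m) and not 1 / (r m^2).\<close>
  have sq: "(\<Sum>k\<in>{-int K..int K}. (norm (c k))\<^sup>2) \<le> c0"
  proof -
    have "(\<Sum>k\<in>{-int K..int K}. (norm (c k))\<^sup>2) = (\<integral>x. (norm (complex_of_real (q x)))\<^sup>2 \<partial>unit_at u)"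
      unfolding c by (rule parseval[symmetric]) simp
    also have "\<dots> \<le> c0" unfolding c0_def
    proof (rule integral_mono)
      fix x
      show "(norm (complex_of_real (q x)))\<^sup>2 \<le> q x"
        using q01[of x] mult_left_mono[of "q x" 1 "q x"] by (simp add: power2_eq_square)
    qed (auto intro!: integrable_unit_at continuous_intros contq)
    finally show ?thesis .
  qed
  have Fm: "F \<in> borel_measurable borel"
    by (intro borel_measurable_continuous_onI contF)
  have c0m: "c0 \<ge> 3 / 4 * m"
  proof -
    define E where "E = {x \<in> {u..u + 1}. t \<le> norm (F x)}"
    have E: "E \<in> sets (unit_at u)" unfolding E_def
      by (rule sets_unit_at_Collect) (use Fm in measurable)
    have hE: "has_bochner_integral (unit_at u) (indicator E) (measure (unit_at u) E)"
      by (rule has_bochner_integral_real_indicator[OF E]) (simp add: M.emeasure_eq_measure)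
    have "integral\<^sup>L (unit_at u) (\<lambda>_. \<eta>) = \<eta>"
      by (simp add: measure_def emeasure_unit_at)
    hence h1: "has_bochner_integral (unit_at u) (\<lambda>_. \<eta>) \<eta>"
      by (simp add: has_bochner_integral_iff)
    note hd = has_bochner_integral_diff[OF hE h1]
    have "m - \<eta> = (\<integral>x. indicator E x - \<eta> \<partial>unit_at u)"
      using has_bochner_integral_integral_eq[OF hd] by (simp add: m_def E_def)
    also have "\<dots> \<le> c0" unfolding c0_def
    proof (rule integral_mono)
      fix x
      show "indicator E x - \<eta> \<le> q x"
      proof (cases "x \<in> E")
        case True
        have "t\<^sup>2 \<le> (norm (F x))\<^sup>2" using True t by (intro power_mono) (auto simp: E_def)
        hence "\<phi> (y x) = 1" using N0 t by (simp add: \<phi>_def y_def field_simps)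
        thus ?thesis using err[of x] True by (simp add: abs_le_iff)
      next
        case False
        have "\<eta> \<ge> 0" by (simp add: \<eta>_def)
        thus ?thesis using False q01[of x] by (simp add: abs_le_iff)
      qed
    qed (rule integrable.intros[OF hd] integrable_unit_at[OF contq])+
    finally show ?thesis using eta by simp
  qed
  define X where "X x = (\<Sum>p\<in>P. complex_of_real (q (real p * x)) - c 0)" for x
  define Z where "Z = {x \<in> {u..u + 1}. \<forall>p\<in>P. norm (F (real p * x)) < t / 2}"
  define L where "L = log 2 (real (Q * K))"
  define r where "r = real (card P)"
  have r0: "r > 0" using P by (simp add: r_def card_gt_0_iff)
  have var: "(\<integral>x. (norm (X x))\<^sup>2 \<partial>unit_at u) \<le> L * r * (\<Sum>k\<in>{-int K..int K}. (norm (c k))\<^sup>2)"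
    unfolding X_def c L_def r_def by (rule prime_dilates_variance) (use P in auto)
  have L0: "L \<ge> 0"
  proof (cases "Q * K = 0")
    case False
    hence "real (Q * K) \<ge> 1" by linarith
    thus ?thesis unfolding L_def by simp
  qed (auto simp: L_def log_def)
  have Zset: "Z \<in> sets (unit_at u)" unfolding Z_def
  proof (rule sets_unit_at_Collect)
    have "(\<lambda>x. F (real p * x)) \<in> borel_measurable borel" for p
      by (intro borel_measurable_continuous_onI continuous_on_compose2[OF contF] continuous_intros) auto
    thus "Measurable.pred borel (\<lambda>x. \<forall>p\<in>P. norm (F (real p * x)) < t / 2)"
      using P(1) by measurable
  qed
  have contX: "continuous_on UNIV X"
    unfolding X_def by (intro continuous_intros continuous_on_compose2[OF contq]) auto
  \<comment> \<open>On \<open>Z\<close> the cutoff vanishes at every dilate, so \<open>q\<close> is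
    there at most \<eta> \<le> m / 4 \<le> c0 / 3, and each of the r summands falls short of the
    mean by 2/3 \<open>c0\<close>.\<close>
  define v where "v = (r * (2 / 3 * c0))\<^sup>2"
  have v0: "v > 0" using r0 c0m m0 by (simp add: v_def)
  have ZX: "Z \<subseteq> {x \<in> space (unit_at u). v \<le> (norm (X x))\<^sup>2}"
  proof
    fix x assume x: "x \<in> Z"
    have small: "q (real p * x) \<le> c0 / 3" if p: "p \<in> P" for p
    proof -
      have "norm (F (real p * x)) < t / 2" using x p by (auto simp: Z_def)
      hence "(norm (F (real p * x)))\<^sup>2 \<le> (t / 2)\<^sup>2" by (intro power_mono) auto
      hence "4 * y (real p * x) * N\<^sup>2 / t\<^sup>2 \<le> 1" using N0 t by (simp add: y_def field_simps)
      hence "\<phi> (y (real p * x)) = 0" by (simp add: \<phi>_def)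
      thus ?thesis using err[of "real p * x"] eta c0m by (simp add: abs_le_iff)
    qed
    have "r * (2 / 3 * c0) = (\<Sum>p\<in>P. 2 / 3 * c0)" by (simp add: r_def)
    also have "\<dots> \<le> (\<Sum>p\<in>P. c0 - q (real p * x))" using small by (intro sum_mono) fastforce
    also have "\<dots> = norm (complex_of_real (\<Sum>p\<in>P. c0 - q (real p * x)))"
      unfolding norm_of_real using small c0m m0 by (intro abs_of_nonneg[symmetric] sum_nonneg) fastforce
    also have "complex_of_real (\<Sum>p\<in>P. c0 - q (real p * x)) = - X x"
      by (simp add: X_def c0 sum_subtractf)
    finally have "r * (2 / 3 * c0) \<le> norm (X x)" by simp
    hence "v \<le> (norm (X x))\<^sup>2" unfolding v_def using r0 c0m m0 by (intro power_mono) auto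
    thus "x \<in> {x \<in> space (unit_at u). v \<le> (norm (X x))\<^sup>2}" using x by (simp add: Z_def)
  qed
  have meas: "{x \<in> space (unit_at u). v \<le> (norm (X x))\<^sup>2} \<in> sets (unit_at u)"
    unfolding space_unit_at
    by (rule sets_unit_at_Collect)
      (use borel_measurable_continuous_onI[OF contX] in measurable)
  have "measure (unit_at u) Z \<le> measure (unit_at u) {x \<in> space (unit_at u). v \<le> (norm (X x))\<^sup>2}"
    by (rule M.finite_measure_mono[OF ZX meas])
  also have "\<dots> \<le> (\<integral>x. (norm (X x))\<^sup>2 \<partial>unit_at u) / v"
    by (rule integral_Markov_inequality_measure[OF _ sets.empty_sets])
      (use v0 in \<open>auto intro!: integrable_unit_at continuous_intros contX\<close>)
  also have "\<dots> \<le> (L * r * c0) / v"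
    using v0 var sq L0 r0 by (intro divide_right_mono order_trans[OF var] mult_left_mono) auto
  also have "\<dots> = 9 / 4 * L / (r * c0)"
    using r0 c0m m0 by (simp add: v_def power2_eq_square field_simps)
  also have "\<dots> \<le> 9 / 4 * L / (r * (3 / 4 * m))"
    using r0 c0m m0 L0 by (intro divide_left_mono mult_left_mono mult_pos_pos) auto
  also have "\<dots> = 3 * L / (r * m)" by simp
  finally show ?thesis by (simp add: Z_def L_def K_def r_def n_def mult_ac)
qed

section \<open>Metric lower bounds for the discrepancy\<close>

lemma star_discrepancy_upper:
  assumes "0 < \<beta>" "\<beta> \<le> 1"
  shows "\<bar>real (count_below x N \<beta>) / real N - \<beta>\<bar> \<le> star_discrepancy x N"
  unfolding star_discrepancy_def
proof (rule cSUP_upper)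
  have "\<bar>real (count_below x N b) / real N - b\<bar> \<le> 1" if "0 < b" "b \<le> 1" for b
  proof -
    have "count_below x N b \<le> card {1..N}" unfolding count_below_def by (rule card_mono) auto
    hence "real (count_below x N b) / real N \<le> 1" by (cases "N = 0") (auto simp: divide_le_eq)
    moreover have "real (count_below x N b) / real N \<ge> 0" by simp
    ultimately show ?thesis using that by linarith
  qed
  thus "bdd_above ((\<lambda>\<beta>. \<bar>real (count_below x N \<beta>) / real N - \<beta>\<bar>) ` {0<..1})"
    by (intro bdd_aboveI2[of _ _ 1]) auto
qed (use assms in auto)

text \<open>Koksma's inequality for one exponential. Integrating the derivative \<open>f\<close>
  from each x n to 1 and adding up gives the integral of A(\<beta>) f(\<beta>), while that of N
  \<beta> f(\<beta>) is N by periodicity. The difference is minus the exponential sum, and |f| = 2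
  pi p.\<close>

lemma exponential_sum_le_star_discrepancy:
  fixes x :: "nat \<Rightarrow> real" and p :: nat
  assumes x: "\<And>n. n \<in> {1..N} \<Longrightarrow> 0 \<le> x n \<and> x n < 1" and p: "p > 0"
  shows "norm (\<Sum>n=1..N. cis (2 * pi * real p * x n)) \<le> 2 * pi * real p * (real N * star_discrepancy x N)"
proof (cases "N = 0")
  case False
  define w where "w = 2 * pi * real p"
  have w: "w > 0" using p by (simp add: w_def)
  define F where "F \<beta> = cis (w * \<beta>)" for \<beta>
  define f where "f \<beta> = \<i> * of_real w * cis (w * \<beta>)" for \<beta>
  have F1: "F 1 = 1" "F 0 = 1"
    unfolding F_def w_def using cis_multiple_2pi[of "real p"] by (simp_all add: mult.commute)
  have cis: "cis (w * \<beta>) = exp (\<i> * (of_real w * of_real \<beta>))" for \<beta> by (simp add: cis_conv_exp)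
  have dF: "(F has_vector_derivative f \<beta>) (at \<beta> within S)" for \<beta> S
  proof -
    have "((\<lambda>z. exp (\<i> * (of_real w * z))) has_field_derivative f \<beta>) (at (of_real \<beta>))"
      by (auto intro!: derivative_eq_intros simp: cis f_def)
    from has_vector_derivative_real_field[OF this] show ?thesis
      by (simp add: F_def[abs_def] cis)
  qed
  define A where "A \<beta> = real (count_below x N \<beta>)" for \<beta>
  have A: "complex_of_real (A \<beta>) = (\<Sum>n=1..N. if x n < \<beta> then 1 else 0)" for \<beta>
  proof -
    have "{n \<in> {1..N}. x n \<in> {0..<\<beta>}} = {n \<in> {1..N}. x n < \<beta>}" using x by auto
    hence "complex_of_real (A \<beta>) = (\<Sum>n\<in>{n \<in> {1..N}. x n < \<beta>}. 1)" by (simp add: A_def count_below_def)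
    also have "\<dots> = (\<Sum>n=1..N. if x n < \<beta> then 1 else 0)" by (intro sum.mono_neutral_cong_left) auto
    finally show ?thesis .
  qed
  have 1: "((\<lambda>\<beta>. if x n < \<beta> then f \<beta> else 0) has_integral (1 - F (x n))) {0..1}" if n: "n \<in> {1..N}" for n
  proof -
    have "(f has_integral (F 1 - F (x n))) {x n..1}"
      by (rule fundamental_theorem_of_calculus) (use x[OF n] dF in auto)
    hence "((\<lambda>\<beta>. if \<beta> \<in> {x n..1} then f \<beta> else 0) has_integral (1 - F (x n))) {0..1}"
      using x[OF n] by (subst has_integral_restrict) (auto simp: F1)
    thus ?thesis
      by (rule has_integral_spike_finite[of "{x n}", rotated 2]) auto
  qed
  have "((\<lambda>\<beta>. \<Sum>n=1..N. if x n < \<beta> then f \<beta> else 0) has_integral (\<Sum>n=1..N. 1 - F (x n))) {0..1}"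
    by (rule has_integral_sum) (use 1 in auto)
  moreover have "(\<Sum>n=1..N. if x n < \<beta> then f \<beta> else 0) = of_real (A \<beta>) * f \<beta>" for \<beta>
    unfolding A sum_distrib_right by (intro sum.cong) auto
  ultimately have 2: "((\<lambda>\<beta>. of_real (A \<beta>) * f \<beta>) has_integral (of_nat N - (\<Sum>n=1..N. F (x n)))) {0..1}"
    by (simp add: sum_subtractf)
  \<comment> \<open>An antiderivative of \<beta> f(\<beta>) found by parts; its last term has equal
    values at 0 and 1.\<close>
  define G where "G \<beta> = of_real \<beta> * F \<beta> - F \<beta> / (\<i> * of_real w)" for \<beta>
  have "((\<lambda>\<beta>. of_real \<beta> * f \<beta>) has_integral (G 1 - G 0)) {0..1}"
  proof (rule fundamental_theorem_of_calculus)
    fix \<beta> :: real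
    have "(G has_vector_derivative (of_real \<beta> * f \<beta> + of_real 1 * F \<beta>) - f \<beta> / (\<i> * of_real w)) (at \<beta> within {0..1})"
      unfolding G_def[abs_def]
      by (intro has_vector_derivative_diff has_vector_derivative_mult has_vector_derivative_of_real
           has_vector_derivative_divide dF DERIV_ident)
    moreover have "f \<beta> / (\<i> * of_real w) = F \<beta>" using w by (simp add: f_def F_def)
    ultimately show "(G has_vector_derivative of_real \<beta> * f \<beta>) (at \<beta> within {0..1})" by simp
  qed simp
  hence "((\<lambda>\<beta>. of_nat N * (of_real \<beta> * f \<beta>)) has_integral of_nat N * 1) {0..1}"
    by (intro has_integral_mult_right) (simp add: G_def F1)
  from has_integral_diff[OF 2 this]
  have 3: "((\<lambda>\<beta>. of_real (A \<beta> - real N * \<beta>) * f \<beta>) has_integral - (\<Sum>n=1..N. F (x n))) {0..1}"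
    by (simp add: algebra_simps)
  define D where "D = real N * star_discrepancy x N"
  have D: "\<bar>A \<beta> - real N * \<beta>\<bar> \<le> D" if "0 < \<beta>" "\<beta> \<le> 1" for \<beta>
  proof -
    have "real N * \<bar>A \<beta> / real N - \<beta>\<bar> \<le> D"
      unfolding A_def D_def by (intro mult_left_mono star_discrepancy_upper that) auto
    also have "real N * \<bar>A \<beta> / real N - \<beta>\<bar> = \<bar>real N * (A \<beta> / real N - \<beta>)\<bar>" by (simp add: abs_mult)
    also have "real N * (A \<beta> / real N - \<beta>) = A \<beta> - real N * \<beta>" using False by (simp add: field_simps)
    finally show ?thesis .
  qed
  have D0: "D \<ge> 0" using D[of 1] by (simp add: order_trans[OF abs_ge_zero])
  have "norm (- (\<Sum>n=1..N. F (x n))) \<le> (w * D) * measure lborel (cbox (0::real) 1)"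
  proof (rule has_integral_bound)
    show "0 \<le> w * D" using w D0 by simp
    show "((\<lambda>\<beta>. of_real (A \<beta> - real N * \<beta>) * f \<beta>) has_integral - (\<Sum>n=1..N. F (x n))) (cbox 0 1)"
      using 3 by simp
    fix \<beta> :: real assume \<beta>: "\<beta> \<in> cbox 0 1"
    have "\<bar>A \<beta> - real N * \<beta>\<bar> \<le> D"
    \<comment> \<open>The supremum in the discrepancy omits \<beta> = 0, where the counting function
      vanishes anyway.\<close>
    proof (cases "\<beta> = 0")
      case True
      have "A 0 = 0" by (simp add: A_def count_below_def)
      thus ?thesis using True D0 by simp
    qed (use D \<beta> in auto)
    hence "w * \<bar>A \<beta> - real N * \<beta>\<bar> \<le> w * D" using w by (intro mult_left_mono) auto
    moreover have "norm (of_real (A \<beta> - real N * \<beta>) * f \<beta>) = w * \<bar>A \<beta> - real N * \<beta>\<bar>"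
      using w unfolding norm_mult norm_of_real f_def by (simp add: norm_mult)
    ultimately show "norm (of_real (A \<beta> - real N * \<beta>) * f \<beta>) \<le> w * D" by simp
  qed
  thus ?thesis by (simp add: F_def w_def D_def)
qed simp

section \<open>Moments and large values of the exponential sum\<close>

lemma trig_second_moment:
  assumes "finite A"
  shows "(\<integral>x. (norm (\<Sum>k\<in>A. e k x))\<^sup>2 \<partial>unit_at u) = real (card A)"
  using parseval[OF assms, where c = "\<lambda>_. 1" and u = u] by simp

text \<open>The squared modulus of the sum has the representation counts as Fourier coefficients, so
  Parseval returns the energy.\<close>

lemma trig_fourth_moment:
  assumes "finite A"
  shows "(\<integral>x. (norm (\<Sum>k\<in>A. e k x)) ^ 4 \<partial>unit_at u) = energy A A"
proof -
  have "(norm (\<Sum>k\<in>A. e k x)) ^ 4 = (norm (\<Sum>d\<in>diffs A A. of_nat (rep A A d) * e d x))\<^sup>2" for x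
  proof -
    have "(\<Sum>d\<in>diffs A A. of_nat (rep A A d) * e d x) = (\<Sum>a\<in>A. \<Sum>b\<in>A. e (a - b) x)"
      by (rule sum_over_differences[OF assms assms, symmetric])
    also have "\<dots> = (\<Sum>k\<in>A. e k x) * cnj (\<Sum>k\<in>A. e k x)"
      by (simp add: sum_product cnj_e flip: e_add)
    also have "\<dots> = complex_of_real ((norm (\<Sum>k\<in>A. e k x))\<^sup>2)"
      by (rule complex_norm_square[symmetric])
    finally show ?thesis by (simp add: norm_power flip: power_mult)
  qed
  thus ?thesis using parseval[of "diffs A A", where c = "\<lambda>d. of_nat (rep A A d)" and u = u] assms
    by (simp add: energy_def)
qed

text \<open>In place of Hoelder, the pointwise inequality |F|^2 \<le> s |F| + |F|^4 / s^2 is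
  integrated. The resulting lower bound for the mean of |F| is then shared among K dyadic levels;
  values of |F| below 1 account for the subtracted 1.\<close>

lemma convex_large_level:
  fixes b :: "nat \<Rightarrow> int"
  defines "F \<equiv> \<lambda>N x. \<Sum>i<N. e (b i) x"
  assumes mono: "strict_mono b" and conv: "strict_mono (\<lambda>i. b (Suc i) - b i)"
    and N: "N > 0" and K: "N < 2 ^ K"
  shows "\<exists>j<K. (real N powr (7/26) / (64 * real K) - 1) / (2 * real K)
      \<le> 2 ^ j * measure (unit_at u) {x \<in> {u..u + 1}. 2 ^ j \<le> norm (F N x)}"
proof -
  define A where "A = b ` {..<N}"
  have A: "card A = N" "finite A" "A \<noteq> {}"
    using strict_mono_imp_inj_on[OF mono] N by (auto simp: A_def card_image inj_on_subset)
  have FA: "F N x = (\<Sum>k\<in>A. e k x)" for x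
    unfolding F_def A_def using strict_mono_imp_inj_on[OF mono]
    by (subst sum.reindex) (auto simp: inj_on_subset)
  have K0: "K > 0" using N K by (cases K) auto
  define E where "E = energy A A"
  have E0: "E > 0" unfolding E_def by (rule energy_self_pos) (use A in auto)
  have E: "E \<le> 2 ^ 9 * real K ^ 2 * real N powr (32/13)"
  proof -
    have "E ^ 26 \<le> 2 ^ 212 * real K ^ 39 * real N ^ 64"
      unfolding E_def A_def by (rule convex_additive_energy[OF mono conv N K])
    \<comment> \<open>Exponents are rounded up to multiples of 26, so that the root can be taken
      exactly: 234 = 9 * 26 and 52 = 2 * 26.\<close>
    also have "\<dots> \<le> 2 ^ 234 * real K ^ 52 * real N ^ 64"
      using K0 by (intro mult_right_mono mult_mono power_increasing) auto
    also have "real N ^ 64 = (real N powr (32/13)) ^ 26"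
      using N by (simp add: powr_power)
    also have "2 ^ 234 * real K ^ 52 * (real N powr (32/13)) ^ 26 = (2 ^ 9 * real K ^ 2 * real N powr (32/13)) ^ 26"
      by (simp add: power_mult_distrib flip: power_mult)
    finally show ?thesis by (rule power_le_imp_le_base[of _ 25, simplified]) auto
  qed
  \<comment> \<open>Chosen so that the fourth moment term E / s^2 uses up exactly half of the second
    moment N.\<close>
  define s where "s = sqrt (2 * E / real N)"
  have s0: "s > 0" using E0 N by (simp add: s_def)
  have s2: "s\<^sup>2 = 2 * E / real N" using E0 by (simp add: s_def)
  have sle: "s \<le> 32 * real K * real N powr (19/26)"
  proof -
    have "s\<^sup>2 \<le> 2 * (2 ^ 9 * real K ^ 2 * real N powr (32/13)) / real N"
      unfolding s2 using E by (intro divide_right_mono mult_left_mono) auto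
    also have "\<dots> = 1024 * real K ^ 2 * (real N powr (32/13) / real N powr 1)" using N by simp
    also have "real N powr (32/13) / real N powr 1 = (real N powr (19/26))\<^sup>2"
      using N by (simp only: powr_diff[symmetric]) (simp add: powr_power)
    also have "1024 * real K ^ 2 * (real N powr (19/26))\<^sup>2 = (32 * real K * real N powr (19/26))\<^sup>2"
      by (simp add: power_mult_distrib)
    finally show ?thesis by (rule power2_le_imp_le) auto
  qed
  have contF: "continuous_on UNIV (F N)" unfolding F_def by (intro continuous_intros)
  define J where "J = (\<integral>x. norm (F N x) \<partial>unit_at u)"
  have "real N = (\<integral>x. (norm (F N x))\<^sup>2 \<partial>unit_at u)"
    unfolding FA using trig_second_moment[OF A(2)] A(1) by simp
  also have "\<dots> \<le> (\<integral>x. s * norm (F N x) + (norm (F N x)) ^ 4 / s\<^sup>2 \<partial>unit_at u)"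
  proof (rule integral_mono)
    fix x
    show "(norm (F N x))\<^sup>2 \<le> s * norm (F N x) + (norm (F N x)) ^ 4 / s\<^sup>2"
    proof (cases "norm (F N x) \<le> s")
      case True
      hence "norm (F N x) * norm (F N x) \<le> s * norm (F N x)" by (intro mult_right_mono) auto
      thus ?thesis by (simp add: power2_eq_square add_increasing2)
    next
      case False
      hence "s\<^sup>2 \<le> (norm (F N x))\<^sup>2" using s0 by (intro power_mono) auto
      hence "s\<^sup>2 * (norm (F N x))\<^sup>2 \<le> (norm (F N x))\<^sup>2 * (norm (F N x))\<^sup>2" by (intro mult_right_mono) auto
      hence "(norm (F N x))\<^sup>2 \<le> (norm (F N x)) ^ 4 / s\<^sup>2"
        using s0 by (simp add: le_divide_eq mult.commute flip: power_add)
      thus ?thesis using s0 by (simp add: add_increasing)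
    qed
  qed (use s0 in \<open>auto intro!: integrable_unit_at continuous_intros contF\<close>)
  also have "\<dots> = s * J + E / s\<^sup>2"
  proof -
    have "(\<integral>x. norm (F N x) ^ 4 \<partial>unit_at u) = E"
      unfolding FA E_def by (rule trig_fourth_moment[OF A(2)])
    moreover have "integrable (unit_at u) (\<lambda>x. s * norm (F N x))" "integrable (unit_at u) (\<lambda>x. norm (F N x) ^ 4 / s\<^sup>2)"
      using s0 by (auto intro!: integrable_unit_at continuous_intros contF)
    ultimately show ?thesis by (simp add: J_def)
  qed
  also have "E / s\<^sup>2 = real N / 2" using E0 N by (simp add: s2)
  finally have "real N / 2 \<le> s * J" by simp
  hence "real N / (2 * s) \<le> J" using s0 by (simp add: field_simps)
  moreover have "real N powr (7/26) / (64 * real K) \<le> real N / (2 * s)"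
  proof -
    have "real N powr (7/26) / (64 * real K) = real N powr 1 / real N powr (19/26) / (64 * real K)"
      by (simp only: powr_diff[symmetric]) simp
    also have "\<dots> = real N / (2 * (32 * real K * real N powr (19/26)))" using N by simp
    also have "\<dots> \<le> real N / (2 * s)"
      using sle s0 N K0 by (intro divide_left_mono mult_left_mono mult_pos_pos) auto
    finally show ?thesis .
  qed
  ultimately have J1: "real N powr (7/26) / (64 * real K) \<le> J" by linarith
  interpret M: finite_measure "unit_at u" by (rule finite_measure_unit_at)
  define L where "L j = {x \<in> {u..u + 1}. 2 ^ j \<le> norm (F N x)}" for j :: nat
  have L: "L j \<in> sets (unit_at u)" for j unfolding L_def
    by (rule sets_unit_at_Collect) (use borel_measurable_continuous_onI[OF contF] in measurable)
  have hL: "has_bochner_integral (unit_at u) (\<lambda>x. 2 ^ (j + 1) * indicator (L j) x) (2 ^ (j + 1) * measure (unit_at u) (L j))" for j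
    by (intro has_bochner_integral_mult_right has_bochner_integral_real_indicator L)
      (simp add: M.emeasure_eq_measure)
  have h1: "has_bochner_integral (unit_at u) (\<lambda>_. 1) (1 :: real)"
    by (simp add: has_bochner_integral_iff measure_def emeasure_unit_at)
  have hsum: "has_bochner_integral (unit_at u) (\<lambda>x. 1 + (\<Sum>j<K. 2 ^ (j + 1) * indicator (L j) x))
      (1 + (\<Sum>j<K. 2 ^ (j + 1) * measure (unit_at u) (L j)))"
    by (intro has_bochner_integral_add h1 has_bochner_integral_sum hL)
  \<comment> \<open>Where |F| \<ge> 1, the summand of the largest power of 2 not exceeding |F|
    already suffices; the others only add.\<close>
  have "J \<le> (\<integral>x. 1 + (\<Sum>j<K. 2 ^ (j + 1) * indicator (L j) x) \<partial>unit_at u)"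
    unfolding J_def
  proof (rule integral_mono)
    show "integrable (unit_at u) (\<lambda>x. norm (F N x))" by (intro integrable_unit_at continuous_intros contF)
    show "integrable (unit_at u) (\<lambda>x. 1 + (\<Sum>j<K. 2 ^ (j + 1) * indicator (L j) x) :: real)"
      by (rule integrable.intros[OF hsum])
    fix x assume x: "x \<in> space (unit_at u)"
    show "norm (F N x) \<le> 1 + (\<Sum>j<K. 2 ^ (j + 1) * indicator (L j) x)"
    proof (cases "norm (F N x) < 1")
      case True
      have "(\<Sum>j<K. 2 ^ (j + 1) * indicator (L j) x) \<ge> (0::real)" by (intro sum_nonneg) auto
      thus ?thesis using True by linarith
    next
      case False
      define v where "v = nat \<lfloor>norm (F N x)\<rfloor>"
      have "v \<ge> 1" using False by (simp add: v_def le_nat_floor)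
      then obtain j where j: "2 ^ j \<le> v" "v < 2 ^ (j + 1)" using ex_power_ivl1[of 2 v] by auto
      have v: "real v \<le> norm (F N x)" "norm (F N x) < real v + 1"
        by (simp_all add: v_def)
      have "norm (F N x) \<le> (\<Sum>i<N. norm (e (b i) x))" unfolding F_def by (rule norm_sum)
      hence "v \<le> N" using v by simp
      hence "2 ^ j \<le> N" using j(1) by (rule order_trans[rotated])
      hence "(2::nat) ^ j < 2 ^ K" by (rule le_less_trans[OF _ K])
      hence jK: "j < K" by simp
      have "real (2 ^ j) \<le> norm (F N x)" using v(1) j(1) by (meson of_nat_mono order_trans)
      hence xL: "x \<in> L j" using x by (simp add: L_def)
      have "real (v + 1) \<le> real (2 ^ (j + 1))" using j(2) by (intro of_nat_mono) simp
      hence "norm (F N x) \<le> 2 ^ (j + 1) * indicator (L j) x" using v(2) xL by simp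
      also have "\<dots> \<le> (\<Sum>j<K. 2 ^ (j + 1) * indicator (L j) x)"
        by (rule member_le_sum) (use jK in auto)
      finally show ?thesis by simp
    qed
  qed
  also have "\<dots> = 1 + (\<Sum>j<K. 2 ^ (j + 1) * measure (unit_at u) (L j))"
    by (rule has_bochner_integral_integral_eq[OF hsum])
  finally have J2: "J \<le> 1 + (\<Sum>j<K. 2 ^ (j + 1) * measure (unit_at u) (L j))" .
  define \<kappa> where "\<kappa> = (real N powr (7/26) / (64 * real K) - 1) / (2 * real K)"
  have "\<exists>j<K. \<kappa> \<le> 2 ^ j * measure (unit_at u) (L j)"
  proof (rule ccontr)
    assume "\<not> ?thesis"
    hence "(\<Sum>j<K. 2 * (2 ^ j * measure (unit_at u) (L j))) < (\<Sum>j<K. 2 * \<kappa>)"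
      using K0 by (intro sum_strict_mono) (auto simp: not_le)
    hence "J < 1 + real K * (2 * \<kappa>)" using J2 by (simp add: mult.assoc)
    also have "\<dots> = real N powr (7/26) / (64 * real K)"
    proof -
      define X where "X = real N powr (7/26) / (64 * real K)"
      have "\<kappa> = (X - 1) / (2 * real K)" by (simp add: \<kappa>_def X_def)
      hence "real K * (2 * \<kappa>) = X - 1" using K0 by simp
      thus ?thesis by (simp add: X_def)
    qed
    finally show False using J1 by simp
  qed
  thus ?thesis unfolding \<kappa>_def L_def .
qed

section \<open>Exceptional sets and their measure\<close>

text \<open>The level t, and with it the range of primes, depends on N and on the unit interval.
  Quantifying over all p > 0 makes the set independent of both and only shrinks it; the factor p in
  the threshold anticipates the loss in the discrepancy bound.\<close>

definition exceptional :: "(nat \<Rightarrow> int) \<Rightarrow> real \<Rightarrow> nat \<Rightarrow> real set" where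
  "exceptional b \<epsilon> N = {x. \<forall>p>0. norm (\<Sum>i<N. e (b i) (real p * x)) < real p * real N powr (7/26 - \<epsilon>)}"

lemma pred_exceptional: "Measurable.pred borel (\<lambda>x. x \<in> exceptional b \<epsilon> N)"
proof -
  have "(\<lambda>x. \<Sum>i<N. e (b i) (real p * x)) \<in> borel_measurable borel" for p
    by (intro borel_measurable_continuous_onI continuous_intros)
  thus ?thesis unfolding exceptional_def mem_Collect_eq by measurable
qed

lemma prime_count_times_ln:
  assumes "2 \<le> Q" "Q \<le> N"
  shows "real Q / 4 \<le> real (card {p::nat. prime p \<and> p \<le> Q}) * ln (real N)"
proof -
  define c where "c = card {p::nat. prime p \<and> p \<le> Q}"
  have "real (2 ^ (Q - 1)) \<le> real (Q ^ c)"
    unfolding c_def using assms by (intro of_nat_mono prime_count_lower_bound) simp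
  hence "ln (2 ^ (Q - 1)) \<le> ln (real Q ^ c)"
    using assms by simp
  hence "real (Q - 1) * ln 2 \<le> real c * ln (real Q)" using assms by (simp add: ln_realpow)
  also have "\<dots> \<le> real c * ln (real N)" using assms by (intro mult_left_mono) auto
  finally have 1: "real (Q - 1) * ln 2 \<le> real c * ln (real N)" .
  have "real Q / 4 = (real Q / 2) * (1 / 2)" by simp
  also have "\<dots> \<le> real (Q - 1) * ln 2"
    using assms ln2_ge_two_thirds by (intro mult_mono) auto
  finally show ?thesis using 1 by (simp add: c_def)
qed

text \<open>With \<mu> = N powr (7/26 - \<epsilon>) and Q about t / (2 \<mu>), an exceptional x has
  |F(p x)| < t / 2 for every prime p \<le> Q. There are at least Q / (4 ln N) of these, so r m is at
  least t m / (16 \<mu> ln N), and t enters only through t m. A quarter of \<epsilon> pays for the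
  logarithms in t m; the other three quarters are the gain.\<close>

lemma exceptional_measure_bound:
  fixes b :: "nat \<Rightarrow> int"
  assumes mono: "strict_mono b" and conv: "strict_mono (\<lambda>i. b (Suc i) - b i)" and b0: "b 0 \<ge> 0"
    and \<epsilon>: "0 < \<epsilon>" "\<epsilon> < 7/26" and N: "N \<ge> 2"
    and N1: "real N powr (7/26 - \<epsilon>/4) \<le>
      (real N powr (7/26) / (64 * (log 2 (real N) + 1)) - 1) / (2 * (log 2 (real N) + 1))"
    and N2: "4 \<le> real N powr (3 * \<epsilon> / 4)"
  shows "measure (unit_at u) {x \<in> {u..u + 1}. x \<in> exceptional b \<epsilon> N}
    \<le> 3 * log 2 (32 * real N ^ 7 * real_of_int (b N)) * (16 * ln (real N)) / real N powr (3 * \<epsilon> / 4)"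
proof -
  interpret M: finite_measure "unit_at u" by (rule finite_measure_unit_at)
  define F where "F x = (\<Sum>i<N. e (b i) x)" for x
  define L where "L = log 2 (real N) + 1"
  have L0: "L > 0" using N by (simp add: L_def add_nonneg_pos)
  define K where "K = nat \<lfloor>log 2 (real N)\<rfloor> + 1"
  have lg: "log 2 (real N) \<ge> 0" using N by simp
  have KL: "real K \<le> L" using lg by (simp add: K_def L_def)
  have "log 2 (real N) < real K" using lg unfolding K_def by linarith
  hence "real N < 2 powr real K" using N by (simp add: log_less_iff)
  hence "real N < real (2 ^ K)" by (simp add: powr_realpow)
  hence NK: "N < 2 ^ K" by (simp only: of_nat_less_iff)
  have K0: "K > 0" by (simp add: K_def)
  obtain j where j: "j < K" "(real N powr (7/26) / (64 * real K) - 1) / (2 * real K)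
      \<le> 2 ^ j * measure (unit_at u) {x \<in> {u..u + 1}. 2 ^ j \<le> norm (F x)}"
    using convex_large_level[OF mono conv _ NK, of u] N unfolding F_def by auto
  define t :: real where "t = 2 ^ j"
  define m where "m = measure (unit_at u) {x \<in> {u..u + 1}. t \<le> norm (F x)}"
  have t1: "t \<ge> 1" by (simp add: t_def)
  have NL: "real N powr (7/26 - \<epsilon>/4) \<le> (real N powr (7/26) / (64 * L) - 1) / (2 * L)"
    using N1 by (simp add: L_def)
  also have "\<dots> \<le> (real N powr (7/26) / (64 * real K) - 1) / (2 * real K)"
  proof (rule frac_le)
    have "0 < real N powr (7/26 - \<epsilon>/4)" using N by simp
    from this NL have "0 < (real N powr (7/26) / (64 * L) - 1) / (2 * L)" by (rule less_le_trans)
    hence p: "0 < real N powr (7/26) / (64 * L) - 1" using L0 by (simp add: zero_less_divide_iff)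
    show q: "real N powr (7/26) / (64 * L) - 1 \<le> real N powr (7/26) / (64 * real K) - 1"
      using KL K0 L0 by (intro diff_right_mono divide_left_mono mult_left_mono mult_pos_pos) auto
    show "0 \<le> real N powr (7/26) / (64 * real K) - 1" using p q by linarith
  qed (use K0 KL in auto)
  also have "\<dots> \<le> t * m" using j(2) by (simp add: t_def m_def)
  finally have tm: "real N powr (7/26 - \<epsilon>/4) \<le> t * m" .
  have FN: "norm (F x) \<le> real N" for x
  proof -
    have "norm (F x) \<le> (\<Sum>i<N. norm (e (b i) x))" unfolding F_def by (rule norm_sum)
    thus ?thesis by simp
  qed
  have pw1: "real N powr (7/26 - \<epsilon>/4) \<ge> 1" using N \<epsilon> by (intro ge_one_powr_ge_zero) auto
  hence "t * m > 0" using tm by linarith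
  hence m0: "m > 0" using t1 by (simp add: zero_less_mult_iff)
  have m1: "m \<le> 1"
    using M.bounded_measure[of "{x \<in> {u..u + 1}. t \<le> norm (F x)}"]
    by (simp add: m_def measure_def[of "unit_at u" "{u..u+1}"] emeasure_unit_at)
  have tN: "t \<le> real N"
  proof (rule ccontr)
    assume "\<not> t \<le> real N"
    hence "norm (F x) < t" for x using FN[of x] by simp
    hence empty: "{x \<in> {u..u + 1}. t \<le> norm (F x)} = {}" by (auto simp: not_le)
    have "m = 0" unfolding m_def empty by simp
    thus False using m0 by simp
  qed
  define \<mu> where "\<mu> = real N powr (7/26 - \<epsilon>)"
  have mu0: "\<mu> > 0" using N by (simp add: \<mu>_def)
  have lam: "real N powr (7/26 - \<epsilon>/4) = \<mu> * real N powr (3 * \<epsilon> / 4)"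
    unfolding \<mu>_def by (simp flip: powr_add)
  \<comment> \<open>This guarantees Q \<ge> 2, so that at least the prime 2 is available.\<close>
  have t4: "4 * \<mu> \<le> t"
  proof -
    have "4 * \<mu> \<le> \<mu> * real N powr (3 * \<epsilon> / 4)" using N2 mu0 by simp
    also have "\<dots> \<le> t * m" using tm lam by simp
    also have "\<dots> \<le> t * 1" using m1 t1 by (intro mult_left_mono) auto
    finally show ?thesis by simp
  qed
  define Q where "Q = nat \<lfloor>t / (2 * \<mu>)\<rfloor>"
  have tmu: "2 \<le> t / (2 * \<mu>)" using t4 mu0 by (simp add: field_simps)
  have Q1: "real Q \<le> t / (2 * \<mu>)" "t / (2 * \<mu>) < real Q + 1" using tmu by (simp_all add: Q_def)
  have Q2: "Q \<ge> 2" using tmu by (simp add: Q_def le_nat_floor)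
  have Q3: "t / (4 * \<mu>) \<le> real Q" using Q1 Q2 by (simp add: field_simps)
  have "\<mu> \<ge> 1" unfolding \<mu>_def using N \<epsilon> by (intro ge_one_powr_ge_zero) auto
  hence "t / (2 * \<mu>) \<le> t / 1" using t1 by (intro divide_left_mono) auto
  hence "real Q \<le> real N" using Q1 tN by simp
  hence QN: "Q \<le> N" by simp
  define P where "P = {p::nat. prime p \<and> p \<le> Q}"
  have finP: "finite P" unfolding P_def by simp
  have "2 \<in> P" using Q2 by (simp add: P_def)
  hence Pne: "P \<noteq> {}" by auto
  define r where "r = real (card P)"
  have rQ: "real Q / 4 \<le> r * ln (real N)" unfolding r_def P_def by (rule prime_count_times_ln[OF Q2 QN])
  have lnN: "ln (real N) > 0" using N by simp
  have rm: "real N powr (3 * \<epsilon> / 4) \<le> r * m * (16 * ln (real N))"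
  proof -
    have "real N powr (3 * \<epsilon> / 4) * \<mu> \<le> t * m" using tm lam by (simp add: mult.commute)
    hence "real N powr (3 * \<epsilon> / 4) \<le> 4 * (t / (4 * \<mu>)) * m" using mu0 by (simp add: field_simps)
    also have "\<dots> \<le> 4 * real Q * m" using Q3 m0 by (intro mult_right_mono mult_left_mono) auto
    also have "\<dots> = 16 * m * (real Q / 4)" by simp
    also have "\<dots> \<le> 16 * m * (r * ln (real N))" using m0 by (intro mult_left_mono rQ) auto
    finally show ?thesis by (simp add: mult_ac)
  qed
  define B where "B = nat (b N)"
  have bpos: "b i \<ge> 0" for i using b0 strict_mono_leD[OF mono, of 0 i] by simp
  have bN: "b N \<ge> 1" using strict_monoD[OF mono, of 0 N] b0 N by simp
  have Ftp: "F \<in> trig_poly B"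
  proof -
    have "(\<lambda>x. \<Sum>i<N. 1 * e (b i) x) \<in> trig_poly B"
    proof (intro trig_poly_sum trig_poly_monomial)
      fix i assume "i \<in> {..<N}"
      hence "b i \<le> b N" using strict_mono_leD[OF mono, of i N] by simp
      thus "\<bar>b i\<bar> \<le> int B" using bpos[of i] bN by (simp add: B_def)
    qed
    thus ?thesis by (simp add: F_def[abs_def])
  qed
  \<comment> \<open>All that is known of m here is m \<ge> 1 / N, from t m \<ge> 1 and t \<le> N; so
    \<open>4 * N\<^sup>2 \<le> m * s\<close> asks for a cube. Its square 16 N^6 leads to the 32 N^7
    in the logarithm.\<close>
  define s where "s = 4 * N ^ 3"
  have mN: "1 \<le> m * real N"
  proof -
    have "1 \<le> t * m" using tm pw1 by linarith
    also have "\<dots> \<le> real N * m" using tN m0 by (intro mult_right_mono) auto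
    finally show ?thesis by (simp add: mult.commute)
  qed
  have "measure (unit_at u) {x \<in> {u..u + 1}. \<forall>p\<in>P. norm (F (real p * x)) < t / 2}
     \<le> 3 * log 2 (real (Q * (2 * B * s\<^sup>2))) / (real (card P) * m)"
    unfolding m_def
  proof (rule large_values_of_dilates[OF Ftp FN t1 tN finP Pne])
    show "s > 0" using N by (simp add: s_def)
    have "4 * (real N)\<^sup>2 * 1 \<le> 4 * (real N)\<^sup>2 * (m * real N)" using mN by (intro mult_left_mono) auto
    thus "4 * (real N)\<^sup>2 \<le> measure (unit_at u) {x \<in> {u..u + 1}. t \<le> norm (F x)} * real s"
      unfolding m_def[symmetric] by (simp add: s_def power2_eq_square power3_eq_cube mult_ac)
  qed (auto simp: P_def)
  also have "\<dots> = 3 * log 2 (real (Q * (2 * B * s\<^sup>2))) / (r * m)" by (simp add: r_def)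
  also have "\<dots> \<le> 3 * log 2 (32 * real N ^ 7 * real_of_int (b N)) / (r * m)"
  proof -
    have "real (Q * (2 * B * s\<^sup>2)) = real Q * (32 * real N ^ 6 * real_of_int (b N))"
      using bN by (simp add: s_def B_def power_mult_distrib flip: power_mult)
    also have "\<dots> \<le> real N * (32 * real N ^ 6 * real_of_int (b N))"
      using QN bN by (intro mult_right_mono) auto
    also have "\<dots> = 32 * real N ^ 7 * real_of_int (b N)" by (simp add: eval_nat_numeral)
    finally have le: "real (Q * (2 * B * s\<^sup>2)) \<le> 32 * real N ^ 7 * real_of_int (b N)" .
    have "Q * (2 * B * s\<^sup>2) > 0" using Q2 bN N by (simp add: B_def s_def)
    hence "real (Q * (2 * B * s\<^sup>2)) > 0" by (simp only: of_nat_0_less_iff)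
    hence "log 2 (real (Q * (2 * B * s\<^sup>2))) \<le> log 2 (32 * real N ^ 7 * real_of_int (b N))"
      using le by simp
    moreover have "r * m \<ge> 0" using m0 by (simp add: r_def)
    ultimately show ?thesis by (intro divide_right_mono) auto
  qed
  also have "\<dots> \<le> 3 * log 2 (32 * real N ^ 7 * real_of_int (b N)) / (real N powr (3 * \<epsilon> / 4) / (16 * ln (real N)))"
  proof (rule divide_left_mono)
    show "real N powr (3 * \<epsilon> / 4) / (16 * ln (real N)) \<le> r * m"
      using rm lnN by (simp add: divide_le_eq)
    have "1 * 1 \<le> (32 * real N ^ 7) * real_of_int (b N)"
      using bN N by (intro mult_mono) (auto intro: order_trans[OF _ mult_mono[of 1 32 1]])
    hence "0 \<le> log 2 (32 * real N ^ 7 * real_of_int (b N))"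
      by (intro zero_le_log_cancel_iff[THEN iffD2]) linarith+
    thus "0 \<le> 3 * log 2 (32 * real N ^ 7 * real_of_int (b N))" by simp
    have "r > 0" using finP Pne by (simp add: r_def card_gt_0_iff)
    thus "0 < r * m * (real N powr (3 * \<epsilon> / 4) / (16 * ln (real N)))" using m0 lnN N by simp
  qed
  finally have main: "measure (unit_at u) {x \<in> {u..u + 1}. \<forall>p\<in>P. norm (F (real p * x)) < t / 2}
     \<le> 3 * log 2 (32 * real N ^ 7 * real_of_int (b N)) * (16 * ln (real N)) / real N powr (3 * \<epsilon> / 4)"
    by simp
  have sub: "{x \<in> {u..u + 1}. x \<in> exceptional b \<epsilon> N} \<subseteq> {x \<in> {u..u + 1}. \<forall>p\<in>P. norm (F (real p * x)) < t / 2}"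
  proof clarify
    fix x p assume x: "x \<in> exceptional b \<epsilon> N" and p: "p \<in> P"
    have "norm (F (real p * x)) < real p * \<mu>"
      using x p prime_gt_0_nat by (auto simp: exceptional_def F_def \<mu>_def P_def)
    also have "\<dots> \<le> real Q * \<mu>" using p mu0 by (intro mult_right_mono) (auto simp: P_def)
    also have "\<dots> \<le> t / 2" using Q1 mu0 by (simp add: field_simps)
    finally show "norm (F (real p * x)) < t / 2" .
  qed
  have contF: "continuous_on UNIV F" by (rule trig_poly_continuous[OF Ftp])
  have "{x \<in> {u..u + 1}. \<forall>p\<in>P. norm (F (real p * x)) < t / 2} \<in> sets (unit_at u)"
  proof (rule sets_unit_at_Collect)
    have "(\<lambda>x. F (real p * x)) \<in> borel_measurable borel" for p
      by (intro borel_measurable_continuous_onI continuous_on_compose2[OF contF] continuous_intros) auto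
    thus "Measurable.pred borel (\<lambda>x. \<forall>p\<in>P. norm (F (real p * x)) < t / 2)"
      using finP by measurable
  qed
  from M.finite_measure_mono[OF sub this] main show ?thesis by linarith
qed

text \<open>Under the logarithm the growth bound becomes a squared logarithm, so
  \<open>\<delta> N\<close> is of order (ln N)^3 / N powr (3 \<epsilon> / 4). The shift
  \<open>n1\<close> lets \<open>b\<close> be a tail of a sequence satisfying the original
  bound.\<close>

lemma AE_not_eventually_exceptional:
  fixes b :: "nat \<Rightarrow> int"
  assumes mono: "strict_mono b" and conv: "strict_mono (\<lambda>i. b (Suc i) - b i)" and b0: "b 0 \<ge> 0"
    and \<gamma>: "\<gamma> > 0" and growth: "\<And>N. real_of_int (b N) \<le> C * exp (\<gamma> * (ln (real N + n1))\<^sup>2)"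
    and \<epsilon>: "0 < \<epsilon>" "\<epsilon> < 7/26"
  shows "AE x in lborel. \<not> eventually (\<lambda>N. x \<in> exceptional b \<epsilon> N) sequentially"
proof -
  have bpos: "b N > 0" if "N > 0" for N using strict_monoD[OF mono that] b0 by simp
  have C: "C > 0"
  proof (rule ccontr)
    assume "\<not> C > 0"
    hence "C * exp (\<gamma> * (ln (real 1 + n1))\<^sup>2) \<le> 0" by (simp add: mult_nonpos_nonneg)
    thus False using growth[of 1] bpos[of 1] by simp
  qed
  define \<delta> where "\<delta> N = 3 * log 2 (32 * real N ^ 7 * (C * exp (\<gamma> * (ln (real N + n1))\<^sup>2))) * (16 * ln (real N))
     / real N powr (3 * \<epsilon> / 4)" for N :: nat
  have lim: "\<delta> \<longlonglongrightarrow> 0" unfolding \<delta>_def using \<epsilon>(1) \<gamma> C by real_asymp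
  have ev1: "eventually (\<lambda>N::nat. real N powr (7/26 - \<epsilon>/4) \<le>
      (real N powr (7/26) / (64 * (log 2 (real N) + 1)) - 1) / (2 * (log 2 (real N) + 1))) sequentially"
    using \<epsilon>(1) by real_asymp
  have ev2: "eventually (\<lambda>N::nat. 4 \<le> real N powr (3 * \<epsilon> / 4)) sequentially"
    using \<epsilon>(1) by real_asymp
  have ev: "eventually (\<lambda>N. measure (unit_at u) {x \<in> {u..u + 1}. x \<in> exceptional b \<epsilon> N} \<le> \<delta> N) sequentially" for u
    using ev1 ev2 eventually_ge_at_top[of 2]
  proof eventually_elim
    case (elim N)
    have "measure (unit_at u) {x \<in> {u..u + 1}. x \<in> exceptional b \<epsilon> N}
      \<le> 3 * log 2 (32 * real N ^ 7 * real_of_int (b N)) * (16 * ln (real N)) / real N powr (3 * \<epsilon> / 4)"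
      by (rule exceptional_measure_bound[OF mono conv b0 \<epsilon> elim(3,1,2)])
    also have "\<dots> \<le> \<delta> N" unfolding \<delta>_def
    proof (intro divide_right_mono mult_right_mono mult_left_mono)
      have "32 * real N ^ 7 * real_of_int (b N) > 0" using elim(3) bpos[of N] by simp
      thus "log 2 (32 * real N ^ 7 * real_of_int (b N)) \<le> log 2 (32 * real N ^ 7 * (C * exp (\<gamma> * (ln (real N + n1))\<^sup>2)))"
        using growth[of N] by (intro log_mono mult_left_mono) auto
    qed (use elim(3) in auto)
    finally show ?case .
  qed
  have AE1: "AE x in unit_at u. \<not> eventually (\<lambda>N. x \<in> exceptional b \<epsilon> N) sequentially" for u
  proof -
    interpret M: finite_measure "unit_at u" by (rule finite_measure_unit_at)
    define Z where "Z m = {x \<in> {u..u + 1}. \<forall>N\<ge>m. x \<in> exceptional b \<epsilon> N}" for m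
    have Z: "Z m \<in> sets (unit_at u)" for m unfolding Z_def
      by (rule sets_unit_at_Collect) (use pred_exceptional in measurable)
    have "measure (unit_at u) (Z m) \<le> 0" for m
    proof (rule tendsto_lowerbound[OF lim])
      show "eventually (\<lambda>N. measure (unit_at u) (Z m) \<le> \<delta> N) sequentially"
        using ev[of u] eventually_ge_at_top[of m]
      proof eventually_elim
        case (elim N)
        have "measure (unit_at u) (Z m) \<le> measure (unit_at u) {x \<in> {u..u + 1}. x \<in> exceptional b \<epsilon> N}"
          using elim(2) by (intro M.finite_measure_mono sets_unit_at_Collect pred_exceptional) (auto simp: Z_def)
        thus ?case using elim(1) by linarith
      qed
    qed simp
    hence "emeasure (unit_at u) (Z m) = 0" for m
      by (simp add: M.emeasure_eq_measure measure_le_0_iff)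
    hence "AE x in unit_at u. x \<notin> Z m" for m
      using Z by (intro AE_not_in null_setsI) auto
    hence "AE x in unit_at u. \<forall>m. x \<notin> Z m" by (simp add: AE_all_countable)
    thus ?thesis
    proof (rule AE_mp, intro AE_I2 impI)
      fix x assume "x \<in> space (unit_at u)" "\<forall>m. x \<notin> Z m"
      thus "\<not> eventually (\<lambda>N. x \<in> exceptional b \<epsilon> N) sequentially"
        by (auto simp: Z_def eventually_sequentially)
    qed
  qed
  have "AE x in lborel. x \<in> {of_int k..of_int k + 1} \<longrightarrow> \<not> eventually (\<lambda>N. x \<in> exceptional b \<epsilon> N) sequentially" for k :: int
  proof -
    have "{of_int k..of_int k + 1} \<inter> space lborel \<in> sets (lborel :: real measure)" by simp
    from AE1[of "of_int k", unfolded unit_at_def AE_restrict_space_iff[OF this]] show ?thesis .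
  qed
  hence "AE x in lborel. \<forall>k::int. x \<in> {of_int k..of_int k + 1} \<longrightarrow> \<not> eventually (\<lambda>N. x \<in> exceptional b \<epsilon> N) sequentially"
    unfolding AE_all_countable by (rule allI)
  thus ?thesis
  proof (rule AE_mp, intro AE_I2 impI)
    fix x :: real
    assume "\<forall>k::int. x \<in> {of_int k..of_int k + 1} \<longrightarrow> \<not> eventually (\<lambda>N. x \<in> exceptional b \<epsilon> N) sequentially"
    moreover have "x \<in> {of_int \<lfloor>x\<rfloor>..of_int \<lfloor>x\<rfloor> + 1}" by (auto simp: less_imp_le)
    ultimately show "\<not> eventually (\<lambda>N. x \<in> exceptional b \<epsilon> N) sequentially" by blast
  qed
qed

section \<open>Passage to an increasing tail and conclusion\<close>

text \<open>Integer gaps that increase strictly are eventually positive, after which the sequence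
  itself passes 0. A nonnegative tail matters because the growth hypothesis bounds the terms only
  from above, whereas the degree of the exponential sum is governed by absolute values.\<close>

lemma convex_eventually_strict_mono:
  fixes a :: "nat \<Rightarrow> int"
  assumes "\<forall>n\<ge>2. a (n + 1) - a n > a n - a (n - 1)"
  obtains m where "m \<ge> 1" "a m \<ge> 0" "strict_mono (\<lambda>i. a (m + i))"
    "strict_mono (\<lambda>i. a (m + Suc i) - a (m + i))"
proof -
  have step: "a (Suc (Suc n)) - a (Suc n) > a (Suc n) - a n" if "n \<ge> 1" for n
    using assms[rule_format, of "Suc n"] that by simp
  have d: "a (Suc (Suc k)) - a (Suc k) \<ge> a 2 - a 1 + int k" for k
  proof (induction k)
    case (Suc k)
    thus ?case using step[of "Suc k"] by simp
  qed (simp add: numeral_2_eq_2)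
  define k where "k = nat \<bar>a 2 - a 1\<bar> + 1"
  have pos: "a (Suc n) - a n \<ge> 1" if "n > k" for n
    using d[of "n - 1"] that by (simp add: k_def)
  define l where "l = Suc k"
  have grow: "a (l + i) \<ge> a l + int i" for i
  proof (induction i)
    case (Suc i)
    thus ?case using pos[of "l + i"] by (simp add: l_def)
  qed simp
  define m where "m = l + nat \<bar>a l\<bar>"
  show ?thesis
  proof
    show "m \<ge> 1" by (simp add: m_def l_def)
    show "a m \<ge> 0" using grow[of "nat \<bar>a l\<bar>"] by (simp add: m_def)
    show "strict_mono (\<lambda>i. a (m + i))"
    proof (rule strict_mono_Suc_iff[THEN iffD2, rule_format])
      fix i show "a (m + i) < a (m + Suc i)" using pos[of "m + i"] by (simp add: m_def l_def)
    qed
    show "strict_mono (\<lambda>i. a (m + Suc i) - a (m + i))"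
    proof (rule strict_mono_Suc_iff[THEN iffD2, rule_format])
      fix i show "a (m + Suc i) - a (m + i) < a (m + Suc (Suc i)) - a (m + Suc i)"
        using step[of "m + i"] by (simp add: m_def l_def)
    qed
  qed
qed

lemma cis_frac: "cis (2 * pi * real p * frac y) = cis (2 * pi * real p * y)"
proof -
  have "2 * pi * real p * y = 2 * pi * real p * frac y + 2 * pi * of_int (int p * \<lfloor>y\<rfloor>)"
    by (simp add: frac_def algebra_simps)
  hence "cis (2 * pi * real p * y) = cis (2 * pi * real p * frac y) * cis (2 * pi * of_int (int p * \<lfloor>y\<rfloor>))"
    by (simp only: cis_mult)
  also have "cis (2 * pi * of_int (int p * \<lfloor>y\<rfloor>)) = 1" by (rule cis_multiple_2pi) (rule Ints_of_int)
  finally show ?thesis by simp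
qed

text \<open>The omitted first terms change the exponential sum by at most m, and p \<ge> 1 lets the
  factor p cancel throughout.\<close>

lemma not_exceptional_imp_discrepancy:
  fixes a :: "nat \<Rightarrow> int"
  assumes "x \<notin> exceptional (\<lambda>i. a (m + i)) \<epsilon> N" "m \<ge> 1"
  defines "M \<equiv> m - 1 + N"
  shows "(real N powr (7/26 - \<epsilon>) - real m) / (2 * pi) \<le> real M * star_discrepancy (\<lambda>n. frac (real_of_int (a n) * x)) M"
proof -
  obtain p where p: "p > 0" "real p * real N powr (7/26 - \<epsilon>) \<le> norm (\<Sum>i<N. e (a (m + i)) (real p * x))"
    using assms(1) by (auto simp: exceptional_def not_less)
  define D where "D = real M * star_discrepancy (\<lambda>n. frac (real_of_int (a n) * x)) M"
  have split: "{1..M} = {1..<m} \<union> {m..<m + N}" using assms(2) by (auto simp: M_def)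
  have "norm (\<Sum>n=1..M. cis (2 * pi * real p * frac (real_of_int (a n) * x))) \<le> 2 * pi * real p * D"
    unfolding D_def by (rule exponential_sum_le_star_discrepancy) (use p(1) in \<open>simp_all add: frac_lt_1\<close>)
  also have "(\<Sum>n=1..M. cis (2 * pi * real p * frac (real_of_int (a n) * x))) = (\<Sum>n=1..M. e (a n) (real p * x))"
    unfolding cis_frac e_def by (simp add: mult_ac)
  also have "\<dots> = (\<Sum>n\<in>{1..<m}. e (a n) (real p * x)) + (\<Sum>n\<in>{m..<m + N}. e (a n) (real p * x))"
    unfolding split by (rule sum.union_disjoint) auto
  also have "(\<Sum>n\<in>{m..<m + N}. e (a n) (real p * x)) = (\<Sum>i<N. e (a (m + i)) (real p * x))"
    by (rule sum.reindex_bij_witness[of _ "\<lambda>i. m + i" "\<lambda>n. n - m"]) auto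
  finally have "norm ((\<Sum>n\<in>{1..<m}. e (a n) (real p * x)) + (\<Sum>i<N. e (a (m + i)) (real p * x))) \<le> 2 * pi * real p * D" .
  moreover have "norm (\<Sum>n\<in>{1..<m}. e (a n) (real p * x)) \<le> real m"
    by (rule order_trans[OF norm_sum]) simp
  ultimately have "norm (\<Sum>i<N. e (a (m + i)) (real p * x)) \<le> 2 * pi * real p * D + real m"
    using norm_triangle_ineq4[of "(\<Sum>n\<in>{1..<m}. e (a n) (real p * x)) + (\<Sum>i<N. e (a (m + i)) (real p * x))"
      "\<Sum>n\<in>{1..<m}. e (a n) (real p * x)"] by simp
  hence "real p * real N powr (7/26 - \<epsilon>) \<le> 2 * pi * real p * D + real m" using p(2) by linarith
  also have "\<dots> \<le> 2 * pi * real p * D + real p * real m"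
    using p(1) mult_right_mono[of 1 "real p" "real m"] by simp
  finally have "real p * (real N powr (7/26 - \<epsilon>) - real m) \<le> real p * (2 * pi * D)"
    by (simp add: algebra_simps)
  hence "real N powr (7/26 - \<epsilon>) - real m \<le> 2 * pi * D" using p(1) by simp
  thus ?thesis by (simp add: D_def field_simps)
qed

text \<open>The exponent s stands for 7/26 - \<epsilon> and is zero or negative for large
  \<epsilon>; the left side grows, is constant or decays accordingly.\<close>

lemma eventually_powr_shift_le:
  fixes r s :: real
  assumes "r > s" "r > 0"
  shows "eventually (\<lambda>N::nat. (real m - 1 + real N) powr s \<le> (real N powr r - real m) / (2 * pi)) sequentially"
proof -
  consider "s > 0" | "s = 0" | "s < 0" by linarith
  thus ?thesis
  proof cases
    case 1 thus ?thesis using assms by real_asymp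
  next
    case 2 thus ?thesis using assms(2) by real_asymp
  next
    case 3 thus ?thesis using assms(2) by real_asymp
  qed
qed

theorem theorem2:
  fixes a :: "nat \<Rightarrow> int" and \<gamma> :: real
  assumes "\<gamma> > 0"
    and "\<exists>C::real. \<forall>n\<ge>1. real_of_int (a n) \<le> C * exp (\<gamma> * (ln (real n))\<^sup>2)"
    and "\<forall>n\<ge>2. a (n + 1) - a n > a n - a (n - 1)"
  shows "AE \<alpha> in lebesgue. \<forall>\<epsilon>>0.
    omega_io (\<lambda>N. real N * star_discrepancy (\<lambda>n. frac (real_of_int (a n) * \<alpha>)) N)
             (\<lambda>N. real N powr (7/26 - \<epsilon>))"
proof -
  obtain C where C: "\<And>n. n \<ge> 1 \<Longrightarrow> real_of_int (a n) \<le> C * exp (\<gamma> * (ln (real n))\<^sup>2)"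
    using assms(2) by auto
  obtain m where m: "m \<ge> 1" "a m \<ge> 0" "strict_mono (\<lambda>i. a (m + i))"
    "strict_mono (\<lambda>i. a (m + Suc i) - a (m + i))"
    using convex_eventually_strict_mono[OF assms(3)] .
  define b where "b = (\<lambda>i. a (m + i))"
  \<comment> \<open>A sequence tending to 0 reduces all \<epsilon> to countably many null sets. The
    4 keeps every term below 7/26, as 1/4 < 7/26.\<close>
  define \<eta> where "\<eta> j = 1 / (real j + 4)" for j :: nat
  have \<eta>: "0 < \<eta> j" "\<eta> j < 7 / 26" for j
    by (auto simp: \<eta>_def field_simps)
  have "AE x in lborel. \<not> eventually (\<lambda>N. x \<in> exceptional b (\<eta> j) N) sequentially" for j
  proof (rule AE_not_eventually_exceptional)
    show "real_of_int (b N) \<le> C * exp (\<gamma> * (ln (real N + real m))\<^sup>2)" for N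
      using C[of "m + N"] m(1) by (simp add: b_def add.commute)
    show "strict_mono b" "strict_mono (\<lambda>i. b (Suc i) - b i)" "b 0 \<ge> 0"
      using m(2-4) unfolding b_def by (simp_all del: add_Suc_right)
  qed (rule assms(1) \<eta>)+
  hence "AE x in lborel. \<forall>j. \<not> eventually (\<lambda>N. x \<in> exceptional b (\<eta> j) N) sequentially"
    by (simp add: AE_all_countable)
  hence "AE x in lebesgue. \<forall>j. \<not> eventually (\<lambda>N. x \<in> exceptional b (\<eta> j) N) sequentially"
    by (rule AE_completion)
  thus ?thesis
  proof (rule AE_mp, intro AE_I2 impI allI)
    fix x \<epsilon> :: real
    assume x: "\<forall>j. \<not> eventually (\<lambda>N. x \<in> exceptional b (\<eta> j) N) sequentially" and \<epsilon>: "\<epsilon> > 0"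
    define D where "D N = real N * star_discrepancy (\<lambda>n. frac (real_of_int (a n) * x)) N" for N
    obtain j where j: "\<eta> j < \<epsilon>"
    proof -
      obtain j where "inverse \<epsilon> < real j" using reals_Archimedean2 by blast
      hence "\<eta> j < \<epsilon>" using \<epsilon> by (simp add: \<eta>_def field_simps)
      thus ?thesis by (rule that)
    qed
    \<comment> \<open>The constant 1 is possible because the room between \<open>\<eta> j\<close>
      and \<epsilon> absorbs 2 pi, the omitted terms and the shift of the index.\<close>
    have "infinite {M. 1 * real M powr (7/26 - \<epsilon>) \<le> D M}"
      unfolding infinite_nat_iff_unbounded_le
    proof
      fix k
      have "eventually (\<lambda>N::nat. (real m - 1 + real N) powr (7/26 - \<epsilon>) \<le> (real N powr (7/26 - \<eta> j) - real m) / (2 * pi)) sequentially"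
        by (rule eventually_powr_shift_le) (use j \<eta> in auto)
      hence "eventually (\<lambda>N. N \<ge> k \<and> (real m - 1 + real N) powr (7/26 - \<epsilon>) \<le> (real N powr (7/26 - \<eta> j) - real m) / (2 * pi)) sequentially"
        by (intro eventually_conj eventually_ge_at_top)
      moreover have "frequently (\<lambda>N. x \<notin> exceptional b (\<eta> j) N) sequentially"
        using x by (simp add: frequently_def)
      ultimately have "frequently (\<lambda>N. x \<notin> exceptional b (\<eta> j) N \<and> N \<ge> k \<and>
          (real m - 1 + real N) powr (7/26 - \<epsilon>) \<le> (real N powr (7/26 - \<eta> j) - real m) / (2 * pi)) sequentially"
        by (rule frequently_eventually_frequently[rotated])
      then obtain N where N: "x \<notin> exceptional b (\<eta> j) N" "N \<ge> k"
        "(real m - 1 + real N) powr (7/26 - \<epsilon>) \<le> (real N powr (7/26 - \<eta> j) - real m) / (2 * pi)"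
        by (auto dest: frequently_ex)
      have le: "(real N powr (7/26 - \<eta> j) - real m) / (2 * pi) \<le> D (m - 1 + N)"
        unfolding D_def by (rule not_exceptional_imp_discrepancy) (use N(1) m(1) in \<open>simp_all add: b_def\<close>)
      have "real m - 1 + real N = real (m - 1 + N)" using m(1) by simp
      hence "real (m - 1 + N) powr (7/26 - \<epsilon>) \<le> D (m - 1 + N)"
        using order_trans[OF N(3) le] by metis
      thus "\<exists>M\<ge>k. M \<in> {M. 1 * real M powr (7/26 - \<epsilon>) \<le> D M}"
        using N(2) by (intro exI[of _ "m - 1 + N"]) (simp only: mem_Collect_eq mult_1, simp)
    qed
    thus "omega_io (\<lambda>N. real N * star_discrepancy (\<lambda>n. frac (real_of_int (a n) * x)) N)
             (\<lambda>N. real N powr (7/26 - \<epsilon>))"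
      unfolding omega_io_def D_def by (intro exI[of _ 1]) simp
  qed
qed

end
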